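(* Let $\Gamma_1,\Gamma_2$ be sets, and let $\mathcal{U}_1$, $\mathcal{U}_2$ be unital operator subspaces of $B(\ell^2(\Gamma_1))$ and $B(\ell^2(\Gamma_2))$ respectively, such that $\mathcal{U}_i$ contains the masa $\ell^\infty(\Gamma_i)$ for $i=1,2$. Let $\theta:\mathcal{U}_1\to\mathcal{U}_2$ be a unital surjective complete isometry. Then $\theta$ is a unitary equivalence, i.e. there exists a unitary $W:\ell^2(\Gamma_1)\to\ell^2(\Gamma_2)$ such that $\theta(T)=WTW^*$ for all $T\in\mathcal{U}_1$.
   Context: All subspaces are assumed norm-closed; a subspace of $B(\mathcal{H})$ is unital if it contains the identity operator. For a set $\Gamma$, $\ell^2(\Gamma)$ is the Hilbert space of square-summable functions $\Gamma\to\mathbb{C}$, and $\ell^\infty(\Gamma)$ is identified with the algebra of multiplication operators $M_f\in B(\ell^2(\Gamma))$, $M_f(g)=fg$, for bounded functions $f:\Gamma\to\mathbb{C}$; it is a masa (maximal abelian self-adjoint subalgebra) of $B(\ell^2(\Gamma))$. A complete isometry is a linear map all of whose matrix amplifications $M_n(\mathcal{U}_1)\to M_n(\mathcal{U}_2)$ are isometric, for the operator norms inherited from $M_n(B(\mathcal{H}))=B(\mathcal{H}^n)$; it is unital if it maps $I$ to $I$. *)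

theory Defs
  imports "HOL-Analysis.Analysis"
begin

section \<open>The Hilbert space of square-summable functions\<close>

typedef 'a ell2 = "{f :: 'a \<Rightarrow> complex. (\<lambda>x. (cmod (f x))\<^sup>2) summable_on UNIV}"
  morphisms ell2_fun Abs_ell2
  by (rule exI[of _ "\<lambda>_. 0"]) simp

setup_lifting type_definition_ell2

lemma ell2_eqI: "(\<And>x. ell2_fun f x = ell2_fun g x) \<Longrightarrow> f = g"
  by (metis ell2_fun_inject ext)

lemma ell2_summable: "(\<lambda>x. (cmod (ell2_fun f x))\<^sup>2) summable_on UNIV"
  using ell2_fun by blast

lemma square_summable_add:
  fixes f g :: "'a \<Rightarrow> complex"
  assumes "(\<lambda>x. (cmod (f x))\<^sup>2) summable_on UNIV" "(\<lambda>x. (cmod (g x))\<^sup>2) summable_on UNIV"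
  shows "(\<lambda>x. (cmod (f x + g x))\<^sup>2) summable_on UNIV"
proof (rule summable_on_comparison_test)
  show "(\<lambda>x. 2 * (cmod (f x))\<^sup>2 + 2 * (cmod (g x))\<^sup>2) summable_on UNIV"
    by (intro summable_on_add summable_on_cmult_right assms)
  fix x
  have "(cmod (f x + g x))\<^sup>2 \<le> (cmod (f x) + cmod (g x))\<^sup>2"
    by (intro power_mono norm_triangle_ineq) auto
  also have "\<dots> \<le> 2 * (cmod (f x))\<^sup>2 + 2 * (cmod (g x))\<^sup>2"
    using sum_squares_bound[of "cmod (f x)" "cmod (g x)"] by (simp add: power2_sum)
  finally show "(cmod (f x + g x))\<^sup>2 \<le> 2 * (cmod (f x))\<^sup>2 + 2 * (cmod (g x))\<^sup>2" .
qed auto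

lemma square_summable_mult:
  fixes f g :: "'a \<Rightarrow> complex"
  assumes "bounded (range f)" "(\<lambda>x. (cmod (g x))\<^sup>2) summable_on UNIV"
  shows "(\<lambda>x. (cmod (f x * g x))\<^sup>2) summable_on UNIV"
proof -
  obtain B where B: "\<And>x. cmod (f x) \<le> B"
    using assms(1) by (auto simp: bounded_iff)
  show ?thesis
  proof (rule summable_on_comparison_test)
    show "(\<lambda>x. B\<^sup>2 * (cmod (g x))\<^sup>2) summable_on UNIV"
      by (intro summable_on_cmult_right assms)
    show "(cmod (f x * g x))\<^sup>2 \<le> B\<^sup>2 * (cmod (g x))\<^sup>2" for x
      by (auto simp: norm_mult power_mult_distrib intro!: mult_right_mono power_mono B)
  qed auto
qed

lemma square_summable_scale:
  fixes g :: "'a \<Rightarrow> complex"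
  assumes "(\<lambda>x. (cmod (g x))\<^sup>2) summable_on UNIV"
  shows "(\<lambda>x. (cmod (c * g x))\<^sup>2) summable_on UNIV"
  using square_summable_mult[of "\<lambda>_. c" g] assms by simp

lift_definition scaleC :: "complex \<Rightarrow> 'a ell2 \<Rightarrow> 'a ell2" (infixr \<open>*\<^sub>C\<close> 75)
  is "\<lambda>c f x. c * f x"
  by (rule square_summable_scale)

definition cinner :: "'a ell2 \<Rightarrow> 'a ell2 \<Rightarrow> complex" where
  "cinner f g = (\<Sum>\<^sub>\<infinity>x. ell2_fun f x * cnj (ell2_fun g x))"

lemma cinner_summable: "(\<lambda>x. ell2_fun f x * cnj (ell2_fun g x)) summable_on UNIV"
proof (rule abs_summable_summable, rule summable_on_comparison_test)
  show "(\<lambda>x. (cmod (ell2_fun f x))\<^sup>2 + (cmod (ell2_fun g x))\<^sup>2) summable_on UNIV"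
    by (intro summable_on_add ell2_summable)
  fix x
  have "2 * cmod (ell2_fun f x) * cmod (ell2_fun g x)
      \<le> (cmod (ell2_fun f x))\<^sup>2 + (cmod (ell2_fun g x))\<^sup>2"
    by (rule sum_squares_bound)
  moreover have "0 \<le> cmod (ell2_fun f x) * cmod (ell2_fun g x)"
    by simp
  ultimately show "norm (ell2_fun f x * cnj (ell2_fun g x))
      \<le> (cmod (ell2_fun f x))\<^sup>2 + (cmod (ell2_fun g x))\<^sup>2"
    unfolding norm_mult complex_mod_cnj by linarith
qed auto

text \<open>The real inner product is the real part of the complex one; it induces the same norm.\<close>

instantiation ell2 :: (type) real_inner
begin

lift_definition zero_ell2 :: "'a ell2" is "\<lambda>_. 0" by simp

lift_definition plus_ell2 :: "'a ell2 \<Rightarrow> 'a ell2 \<Rightarrow> 'a ell2" is "\<lambda>f g x. f x + g x"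
  by (rule square_summable_add)

lift_definition uminus_ell2 :: "'a ell2 \<Rightarrow> 'a ell2" is "\<lambda>f x. - f x" by simp

definition minus_ell2 :: "'a ell2 \<Rightarrow> 'a ell2 \<Rightarrow> 'a ell2" where
  "minus_ell2 f g = f + (- g)"

definition scaleR_ell2 :: "real \<Rightarrow> 'a ell2 \<Rightarrow> 'a ell2" where
  "scaleR_ell2 r f = scaleC (complex_of_real r) f"

definition inner_ell2 :: "'a ell2 \<Rightarrow> 'a ell2 \<Rightarrow> real" where
  "inner_ell2 f g = Re (cinner f g)"

definition norm_ell2 :: "'a ell2 \<Rightarrow> real" where
  "norm_ell2 f = sqrt (\<Sum>\<^sub>\<infinity>x. (cmod (ell2_fun f x))\<^sup>2)"

definition sgn_ell2 :: "'a ell2 \<Rightarrow> 'a ell2" where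
  "sgn_ell2 f = scaleR (inverse (norm f)) f"

definition dist_ell2 :: "'a ell2 \<Rightarrow> 'a ell2 \<Rightarrow> real" where
  "dist_ell2 f g = norm (f - g)"

definition uniformity_ell2 :: "('a ell2 \<times> 'a ell2) filter" where
  "uniformity_ell2 = (INF e\<in>{0<..}. principal {(f, g). dist f g < e})"

definition open_ell2 :: "'a ell2 set \<Rightarrow> bool" where
  "open_ell2 S = (\<forall>f\<in>S. \<forall>\<^sub>F (f', g) in uniformity. f' = f \<longrightarrow> g \<in> S)"

lemma cinner_self: "cinner f f = complex_of_real (\<Sum>\<^sub>\<infinity>x. (cmod (ell2_fun f x))\<^sup>2)"
proof -
  have "((\<lambda>x. (cmod (ell2_fun f x))\<^sup>2) has_sum (\<Sum>\<^sub>\<infinity>x. (cmod (ell2_fun f x))\<^sup>2)) UNIV"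
    using ell2_summable by (rule has_sum_infsum)
  then have "((\<lambda>x. complex_of_real ((cmod (ell2_fun f x))\<^sup>2)) has_sum
      complex_of_real (\<Sum>\<^sub>\<infinity>x. (cmod (ell2_fun f x))\<^sup>2)) UNIV"
    by (rule has_sum_of_real)
  then show ?thesis
    unfolding cinner_def by (simp add: infsumI complex_norm_square[symmetric])
qed

instance
proof
  fix f g h :: "'a ell2" and r s :: real
  show "f + g + h = f + (g + h)" by transfer (simp add: add.assoc)
  show "f + g = g + f" by transfer (simp add: add.commute)
  show "0 + f = f" by transfer simp
  show "- f + f = 0" by transfer simp
  show "f - g = f + - g" by (simp add: minus_ell2_def)
  show "r *\<^sub>R (f + g) = r *\<^sub>R f + r *\<^sub>R g"
    unfolding scaleR_ell2_def by transfer (simp add: distrib_left)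
  show "(r + s) *\<^sub>R f = r *\<^sub>R f + s *\<^sub>R f"
    unfolding scaleR_ell2_def by transfer (simp add: distrib_right)
  show "r *\<^sub>R s *\<^sub>R f = (r * s) *\<^sub>R f"
    unfolding scaleR_ell2_def by transfer (simp add: mult.assoc)
  show "1 *\<^sub>R f = f"
    unfolding scaleR_ell2_def by transfer simp
  show "inner f g = inner g f"
  proof -
    have "cinner f g = cnj (cinner g f)"
      unfolding cinner_def by (simp flip: infsum_cnj add: mult.commute)
    then show ?thesis by (simp add: inner_ell2_def)
  qed
  show "inner (f + g) h = inner f h + inner g h"
    unfolding inner_ell2_def cinner_def plus_ell2.rep_eq
    by (simp add: distrib_right infsum_add cinner_summable)
  show "inner (r *\<^sub>R f) g = r * inner f g"
    unfolding inner_ell2_def cinner_def scaleR_ell2_def scaleC.rep_eq mult.assoc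
    by (subst infsum_cmult_right) (auto simp: cinner_summable)
  show "0 \<le> inner f f"
    by (simp add: inner_ell2_def cinner_self infsum_nonneg)
  show "inner f f = 0 \<longleftrightarrow> f = 0"
  proof
    assume "inner f f = 0"
    then have *: "(\<Sum>\<^sub>\<infinity>x. (cmod (ell2_fun f x))\<^sup>2) = 0"
      by (simp add: inner_ell2_def cinner_self)
    have "(cmod (ell2_fun f x))\<^sup>2 = 0" for x
      by (rule nonneg_infsum_le_0D[of _ UNIV]) (use * ell2_summable in auto)
    then show "f = 0"
      by (intro ell2_eqI) (simp add: zero_ell2.rep_eq)
  next
    assume "f = 0"
    then show "inner f f = 0"
      by (simp add: inner_ell2_def cinner_def zero_ell2.rep_eq)
  qed
  show "norm f = sqrt (inner f f)"
    by (simp add: norm_ell2_def inner_ell2_def cinner_self)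
qed (simp_all add: sgn_ell2_def dist_ell2_def uniformity_ell2_def open_ell2_def)

end

lemma norm_scaleC: "norm (c *\<^sub>C f) = cmod c * norm f"
  unfolding norm_ell2_def scaleC.rep_eq
  by (simp add: norm_mult power_mult_distrib infsum_cmult_right ell2_summable real_sqrt_mult)

lemma bounded_linear_scaleC: "bounded_linear (scaleC c :: 'a ell2 \<Rightarrow> 'a ell2)"
proof (rule bounded_linear_intro)
  fix f g :: "'a ell2" and r :: real
  show "c *\<^sub>C (f + g) = c *\<^sub>C f + c *\<^sub>C g"
    by transfer (simp add: distrib_left)
  show "c *\<^sub>C (r *\<^sub>R f) = r *\<^sub>R (c *\<^sub>C f)"
    unfolding scaleR_ell2_def by transfer (simp add: mult.left_commute)
  show "norm (c *\<^sub>C f) \<le> norm f * cmod c"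
    by (simp add: norm_scaleC mult.commute)
qed


section \<open>Operators\<close>

text \<open>
  For a set \<open>\<Gamma> :: 'a set\<close> (possibly empty), \<open>\<ell>\<^sup>2(\<Gamma>)\<close> is the closed subspace of functions in
  \<open>'a ell2\<close> that vanish off \<open>\<Gamma>\<close>. A bounded complex-linear operator from \<open>\<ell>\<^sup>2(\<Gamma>)\<close> to
  \<open>\<ell>\<^sup>2(\<Delta>)\<close> is represented by its extension by zero on the orthogonal complement of
  \<open>\<ell>\<^sup>2(\<Gamma>)\<close>. This preserves the operator norm, sums, products and adjoints.
\<close>

definition ell2_on :: "'a set \<Rightarrow> 'a ell2 set" where
  "ell2_on \<Gamma> = {f. \<forall>x. x \<notin> \<Gamma> \<longrightarrow> ell2_fun f x = 0}"

definition bounded_ops :: "'a set \<Rightarrow> 'b set \<Rightarrow> ('a ell2 \<Rightarrow>\<^sub>L 'b ell2) set" where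
  "bounded_ops \<Gamma> \<Delta> =
     {T :: 'a ell2 \<Rightarrow>\<^sub>L 'b ell2.
        (\<forall>c f. T (c *\<^sub>C f) = c *\<^sub>C T f) \<and>
        (\<forall>f. T f \<in> ell2_on \<Delta>) \<and>
        (\<forall>f\<in>ell2_on (- \<Gamma>). T f = 0)}"

definition scale_op :: "complex \<Rightarrow> ('a ell2 \<Rightarrow>\<^sub>L 'b ell2) \<Rightarrow> ('a ell2 \<Rightarrow>\<^sub>L 'b ell2)" where
  "scale_op c T = Blinfun (\<lambda>f. c *\<^sub>C T f)"

lemma scale_op_apply [simp]: "scale_op c T f = c *\<^sub>C T f"
  unfolding scale_op_def
  by (simp add: bounded_linear_Blinfun_apply
      bounded_linear_compose[OF bounded_linear_scaleC blinfun.bounded_linear_right])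

text \<open>
  Multiplication by \<open>\<phi>\<close> on \<open>\<ell>\<^sup>2(\<Gamma>)\<close>; meaningful only if \<open>\<phi>\<close> is bounded on \<open>\<Gamma>\<close>
  (see \<open>mult_op_apply\<close>).
\<close>

definition mult_op :: "'a set \<Rightarrow> ('a \<Rightarrow> complex) \<Rightarrow> ('a ell2 \<Rightarrow>\<^sub>L 'a ell2)" where
  "mult_op \<Gamma> \<phi> = Blinfun (\<lambda>g. Abs_ell2 (\<lambda>x. if x \<in> \<Gamma> then \<phi> x * ell2_fun g x else 0))"

lemma mult_op_apply:
  assumes "bounded (\<phi> ` \<Gamma>)"
  shows "ell2_fun (mult_op \<Gamma> \<phi> g) x = (if x \<in> \<Gamma> then \<phi> x * ell2_fun g x else 0)"
proof -
  define \<psi> where "\<psi> = (\<lambda>x. if x \<in> \<Gamma> then \<phi> x else 0)"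
  obtain B where B: "\<And>x. x \<in> \<Gamma> \<Longrightarrow> cmod (\<phi> x) \<le> B"
    using assms by (auto simp: bounded_iff)
  have B': "cmod (\<psi> x) \<le> max B 0" for x
    using B[of x] by (auto simp: \<psi>_def)
  then have bd: "bounded (range \<psi>)"
    by (auto simp: bounded_iff)
  have eq: "(\<lambda>x. if x \<in> \<Gamma> then \<phi> x * ell2_fun g x else 0) = (\<lambda>x. \<psi> x * ell2_fun g x)" for g
    by (auto simp: \<psi>_def)
  define M where "M = (\<lambda>g. Abs_ell2 (\<lambda>x. \<psi> x * ell2_fun g x))"
  have M: "ell2_fun (M g) = (\<lambda>x. \<psi> x * ell2_fun g x)" for g
    unfolding M_def
    by (rule Abs_ell2_inverse) (simp add: square_summable_mult[OF bd ell2_summable])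
  have "bounded_linear M"
  proof (rule bounded_linear_intro)
    fix f g :: "'a ell2" and r :: real
    show "M (f + g) = M f + M g"
      by (rule ell2_eqI) (simp add: M plus_ell2.rep_eq distrib_left)
    show "M (r *\<^sub>R f) = r *\<^sub>R M f"
      by (rule ell2_eqI) (simp add: M scaleR_ell2_def scaleC.rep_eq)
    have "(\<Sum>\<^sub>\<infinity>x. (cmod (\<psi> x * ell2_fun f x))\<^sup>2) \<le> (\<Sum>\<^sub>\<infinity>x. (max B 0)\<^sup>2 * (cmod (ell2_fun f x))\<^sup>2)"
    proof (rule infsum_mono)
      show "(cmod (\<psi> x * ell2_fun f x))\<^sup>2 \<le> (max B 0)\<^sup>2 * (cmod (ell2_fun f x))\<^sup>2" for x
        unfolding norm_mult power_mult_distrib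
        by (intro mult_right_mono power_mono B') auto
    qed (auto intro!: square_summable_mult[OF bd ell2_summable] summable_on_cmult_right ell2_summable)
    also have "\<dots> = (max B 0)\<^sup>2 * (\<Sum>\<^sub>\<infinity>x. (cmod (ell2_fun f x))\<^sup>2)"
      by (simp add: infsum_cmult_right ell2_summable)
    finally have "norm (M f) \<le> sqrt ((max B 0)\<^sup>2 * (\<Sum>\<^sub>\<infinity>x. (cmod (ell2_fun f x))\<^sup>2))"
      unfolding norm_ell2_def M by (rule real_sqrt_le_mono)
    then show "norm (M f) \<le> norm f * max B 0"
      by (simp add: norm_ell2_def real_sqrt_mult mult.commute)
  qed
  then have "mult_op \<Gamma> \<phi> g = M g"
    unfolding mult_op_def eq M_def[symmetric] by (simp add: bounded_linear_Blinfun_apply)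
  then show ?thesis by (simp add: M \<psi>_def)
qed

definition linfty_ops :: "'a set \<Rightarrow> ('a ell2 \<Rightarrow>\<^sub>L 'a ell2) set" where
  "linfty_ops \<Gamma> = {mult_op \<Gamma> \<phi> | \<phi>. bounded (\<phi> ` \<Gamma>)}"

definition id_op :: "'a set \<Rightarrow> ('a ell2 \<Rightarrow>\<^sub>L 'a ell2)" where
  "id_op \<Gamma> = mult_op \<Gamma> (\<lambda>_. 1)"

lemma id_op_apply: "f \<in> ell2_on \<Gamma> \<Longrightarrow> id_op \<Gamma> f = f"
  by (rule ell2_eqI) (auto simp: id_op_def mult_op_apply ell2_on_def image_constant_conv)

definition adj :: "('a ell2 \<Rightarrow>\<^sub>L 'b ell2) \<Rightarrow> ('b ell2 \<Rightarrow>\<^sub>L 'a ell2)" where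
  "adj T = (THE S :: 'b ell2 \<Rightarrow>\<^sub>L 'a ell2. \<forall>f g. cinner (T f) g = cinner f (S g))"

lemma adj_eqI:
  assumes "\<And>f g. cinner (blinfun_apply T f) g = cinner f (blinfun_apply S g)"
  shows "adj T = S"
  unfolding adj_def
proof (rule the_equality)
  fix S' assume S': "\<forall>f g. cinner (blinfun_apply T f) g = cinner f (blinfun_apply S' g)"
  have "inner f (S' g) = inner f (S g)" for f g
    using S' assms by (simp add: inner_ell2_def)
  then have "inner (S' g - S g) (S' g - S g) = 0" for g
    by (simp add: inner_diff_right)
  then show "S' = S"
    by (intro blinfun_eqI) simp
qed (use assms in blast)

definition unitary_op :: "'a set \<Rightarrow> 'b set \<Rightarrow> ('a ell2 \<Rightarrow>\<^sub>L 'b ell2) \<Rightarrow> bool" where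
  "unitary_op \<Gamma> \<Delta> W \<longleftrightarrow>
     W \<in> bounded_ops \<Gamma> \<Delta> \<and> adj W o\<^sub>L W = id_op \<Gamma> \<and> W o\<^sub>L adj W = id_op \<Delta>"


section \<open>Operator spaces and complete isometries\<close>

definition operator_space :: "'a set \<Rightarrow> ('a ell2 \<Rightarrow>\<^sub>L 'a ell2) set \<Rightarrow> bool" where
  "operator_space \<Gamma> \<U> \<longleftrightarrow>
     \<U> \<subseteq> bounded_ops \<Gamma> \<Gamma> \<and> closed \<U> \<and> 0 \<in> \<U> \<and>
     (\<forall>S\<in>\<U>. \<forall>T\<in>\<U>. S + T \<in> \<U>) \<and> (\<forall>c. \<forall>T\<in>\<U>. scale_op c T \<in> \<U>)"

definition unital_operator_space :: "'a set \<Rightarrow> ('a ell2 \<Rightarrow>\<^sub>L 'a ell2) set \<Rightarrow> bool" where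
  "unital_operator_space \<Gamma> \<U> \<longleftrightarrow> operator_space \<Gamma> \<U> \<and> id_op \<Gamma> \<in> \<U>"

text \<open>
  The norm of an \<open>n \<times> n\<close> matrix of operators acting on \<open>H\<^sup>n\<close>, with
  \<open>\<parallel>(\<xi>\<^sub>j)\<parallel>\<^sup>2 = \<Sum>\<^sub>j \<parallel>\<xi>\<^sub>j\<parallel>\<^sup>2\<close>. Only the entries \<open>A i j\<close> with \<open>i, j < n\<close> matter.
\<close>

definition matrix_op_norm :: "nat \<Rightarrow> (nat \<Rightarrow> nat \<Rightarrow> ('a ell2 \<Rightarrow>\<^sub>L 'a ell2)) \<Rightarrow> real" where
  "matrix_op_norm n A =
     (SUP \<xi>\<in>{\<xi> :: nat \<Rightarrow> 'a ell2. (\<Sum>j<n. (norm (\<xi> j))\<^sup>2) \<le> 1}.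
        sqrt (\<Sum>i<n. (norm (\<Sum>j<n. A i j (\<xi> j)))\<^sup>2))"

lemma matrix_op_norm_bdd_above:
  fixes A :: "nat \<Rightarrow> nat \<Rightarrow> ('a ell2 \<Rightarrow>\<^sub>L 'a ell2)"
  shows "bdd_above ((\<lambda>\<xi>. sqrt (\<Sum>i<n. (norm (\<Sum>j<n. A i j (\<xi> j)))\<^sup>2)) `
                      {\<xi>. (\<Sum>j<n. (norm (\<xi> j))\<^sup>2) \<le> 1})"
proof (rule bdd_aboveI2)
  fix \<xi> :: "nat \<Rightarrow> 'a ell2"
  assume "\<xi> \<in> {\<xi>. (\<Sum>j<n. (norm (\<xi> j))\<^sup>2) \<le> 1}"
  then have le: "(\<Sum>j<n. (norm (\<xi> j))\<^sup>2) \<le> 1" by simp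
  have "norm (\<xi> j) \<le> 1" if "j < n" for j
  proof -
    have "(norm (\<xi> j))\<^sup>2 \<le> (\<Sum>j<n. (norm (\<xi> j))\<^sup>2)"
      by (rule member_le_sum) (use that in auto)
    with le have "(norm (\<xi> j))\<^sup>2 \<le> 1" by linarith
    then show ?thesis by (simp add: power_le_one_iff)
  qed
  then have "norm (A i j (\<xi> j)) \<le> norm (A i j)" if "j < n" for i j
    using norm_blinfun[of "A i j" "\<xi> j"] that
    by (meson mult_left_le norm_ge_zero order_trans)
  then have "norm (\<Sum>j<n. A i j (\<xi> j)) \<le> (\<Sum>j<n. norm (A i j))" for i
    by (intro sum_norm_le) auto
  then show "sqrt (\<Sum>i<n. (norm (\<Sum>j<n. A i j (\<xi> j)))\<^sup>2) \<le> sqrt (\<Sum>i<n. (\<Sum>j<n. norm (A i j))\<^sup>2)"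
    by (intro real_sqrt_le_mono sum_mono power_mono) auto
qed

definition complete_isometry ::
  "('a ell2 \<Rightarrow>\<^sub>L 'a ell2) set \<Rightarrow> ('b ell2 \<Rightarrow>\<^sub>L 'b ell2) set \<Rightarrow>
   (('a ell2 \<Rightarrow>\<^sub>L 'a ell2) \<Rightarrow> ('b ell2 \<Rightarrow>\<^sub>L 'b ell2)) \<Rightarrow> bool" where
  "complete_isometry \<U> \<V> \<theta> \<longleftrightarrow>
     (\<forall>T\<in>\<U>. \<theta> T \<in> \<V>) \<and>
     (\<forall>S\<in>\<U>. \<forall>T\<in>\<U>. \<theta> (S + T) = \<theta> S + \<theta> T) \<and>
     (\<forall>c. \<forall>T\<in>\<U>. \<theta> (scale_op c T) = scale_op c (\<theta> T)) \<and>
     (\<forall>n A. (\<forall>i<n. \<forall>j<n. A i j \<in> \<U>) \<longrightarrow>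
        matrix_op_norm n (\<lambda>i j. \<theta> (A i j)) = matrix_op_norm n A)"

end

theory Submission
  imports Defs
begin

text \<open>
  Write \<open>p\<^sub>x\<close> for the projection onto the coordinate vector \<open>ket x\<close>, and \<open>\<psi>\<close> for the inverse of \<open>\<theta>\<close>,
  which is again a unital complete isometry. The theorem can be understood through the
  \<open>C\<^sup>*\<close>-envelope: since the masa lies in the operator space, a nonzero ideal of the generated
  \<open>C\<^sup>*\<close>-algebra contains some \<open>p\<^sub>x\<close>, so a quotient that is isometric on the space has no kernel, and
  \<open>\<theta>\<close> extends to a \<open>*\<close>-isomorphism. The proof below extracts what is needed of this picture
  directly from matrix norms, without extending \<open>\<theta>\<close> beyond the given space.

  The analytic engine is a peaking argument. Let \<open>P j\<close> be rank one projections onto unit vectors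
  \<open>v j\<close>. For a large number \<open>N\<close>, a unit vector that nearly attains the norm of the matrix with blocks
  \<open>N diag(P j)\<close> and \<open>T i j\<close> has its components close to multiples of \<open>v j\<close>; hence this norm
  determines, up to an error that tends to zero, the norm of the scalar-indexed operator
  \<open>a \<mapsto> (\<Sum>j. a j T i j (v j))\<^sub>i\<close>. Since \<open>\<theta>\<close> preserves the norm, this compression to the \<open>v j\<close> dominates
  the compression of \<open>\<theta> (T i j)\<close> to unit vectors almost fixed by \<open>\<theta> (P j)\<close>
  (\<open>column_compression_bound\<close>). Adding large multiples of the identity turns the comparison of norms
  into a comparison of numerical ranges (\<open>form_compression_bound\<close>).

  Three consequences give the theorem. First, let \<open>q = \<theta> p\<^sub>x\<close>. The contractions
  \<open>p\<^sub>x + z (1 - p\<^sub>x)\<close> with \<open>|z| = 1\<close> force the form \<open>\<langle>q f, (1 - q) g\<rangle>\<close> to be nonnegative, and the peaking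
  argument for \<open>\<psi>\<close> at \<open>p\<^sub>y\<close> shows that it vanishes at every \<open>ket y\<close>; so \<open>q\<close> is a projection
  (\<open>image_projection\<close>), and comparing coordinates shows that it has rank one (\<open>image_rank_one\<close>). The
  spanning vectors \<open>peak x\<close> form an orthonormal basis (\<open>peak_orthonormal\<close>, \<open>peak_complete\<close>).

  Second, the matrix entries of \<open>T\<close> and \<open>\<theta> T\<close> in the two bases have the same modulus
  (\<open>norm_image_entry\<close>).

  Third, their phases differ by a coboundary. Along a closed walk through nonzero entries, place
  operators realizing these entries in a cyclic matrix pattern: the numerical range of a cyclic
  matrix with unimodular entries reaches the maximal value only if the product of the phases is
  one (\<open>cyclic_phase_gap\<close>), and \<open>\<psi>\<close> transports this bound to the original entries, all normalized
  to one (\<open>phase_cycle\<close>). Hence phases \<open>g x\<close> can be chosen along walks (\<open>phase_gauge\<close>), and the unitary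
  \<open>W\<close> with \<open>W (ket x) = g x *\<^sub>C peak x\<close> implements \<open>\<theta>\<close>.
\<close>

section \<open>Sesquilinear algebra in the space of square-summable functions\<close>

lemma scaleC_add_right: "c *\<^sub>C (f + g) = c *\<^sub>C f + c *\<^sub>C g"
  by transfer (simp add: distrib_left)

lemma scaleC_add_left: "(c + d) *\<^sub>C f = c *\<^sub>C f + d *\<^sub>C f"
  by transfer (simp add: distrib_right)

lemma scaleC_scaleC [simp]: "c *\<^sub>C d *\<^sub>C f = (c * d) *\<^sub>C f"
  by transfer (simp add: mult.assoc)

lemma scaleC_one [simp]: "1 *\<^sub>C f = f"
  by transfer simp

lemma scaleC_zero_left [simp]: "0 *\<^sub>C f = 0"
  by transfer simp

lemma scaleC_zero_right [simp]: "c *\<^sub>C 0 = 0"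
  by transfer simp

lemma scaleC_minus_left: "(- c) *\<^sub>C f = - (c *\<^sub>C f)"
  by transfer simp

lemma scaleC_diff_right: "c *\<^sub>C (f - g) = c *\<^sub>C f - c *\<^sub>C g"
  by (rule bounded_linear.linear[OF bounded_linear_scaleC, THEN linear_diff])

lemma scaleC_sum_right: "c *\<^sub>C (\<Sum>i\<in>A. f i) = (\<Sum>i\<in>A. c *\<^sub>C f i)"
  by (rule bounded_linear.linear[OF bounded_linear_scaleC, THEN linear_sum])

lemma scaleR_eq_scaleC: "r *\<^sub>R f = complex_of_real r *\<^sub>C f" for f :: "'a ell2"
  by (simp add: scaleR_ell2_def)

lemma ell2_fun_diff: "ell2_fun (f - g) x = ell2_fun f x - ell2_fun g x"
  unfolding minus_ell2_def by (simp add: plus_ell2.rep_eq uminus_ell2.rep_eq del: add_uminus_conv_diff)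

lemma ell2_fun_sum: "ell2_fun (\<Sum>i\<in>A. f i) x = (\<Sum>i\<in>A. ell2_fun (f i) x)"
  by (induction A rule: infinite_finite_induct) (auto simp: zero_ell2.rep_eq plus_ell2.rep_eq)

lemma cinner_commute: "cinner f g = cnj (cinner g f)"
  unfolding cinner_def by (simp flip: infsum_cnj add: mult.commute)

lemma cinner_add_left: "cinner (f + g) h = cinner f h + cinner g h"
  unfolding cinner_def plus_ell2.rep_eq
  by (simp add: distrib_right infsum_add cinner_summable)

lemma cinner_scaleC_left: "cinner (c *\<^sub>C f) g = c * cinner f g"
  unfolding cinner_def scaleC.rep_eq mult.assoc
  by (subst infsum_cmult_right) (auto simp: cinner_summable)

lemma cinner_add_right: "cinner h (f + g) = cinner h f + cinner h g"
  by (metis cinner_add_left cinner_commute complex_cnj_add)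

lemma cinner_scaleC_right: "cinner g (c *\<^sub>C f) = cnj c * cinner g f"
  by (metis cinner_scaleC_left cinner_commute complex_cnj_mult)

lemma cinner_zero_left [simp]: "cinner 0 f = 0"
  by (metis cinner_scaleC_left scaleC_zero_left mult_zero_left)

lemma cinner_zero_right [simp]: "cinner f 0 = 0"
  by (metis cinner_commute cinner_zero_left complex_cnj_zero)

lemma cinner_minus_left: "cinner (- f) g = - cinner f g"
  by (metis cinner_scaleC_left mult_minus1 scaleC_minus_left scaleC_one)

lemma cinner_minus_right: "cinner f (- g) = - cinner f g"
  by (metis cinner_commute cinner_minus_left complex_cnj_minus)

lemma cinner_diff_right: "cinner h (f - g) = cinner h f - cinner h g"
  unfolding minus_ell2_def by (simp add: cinner_add_right cinner_minus_right del: add_uminus_conv_diff)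

lemma cinner_sum_left: "cinner (\<Sum>i\<in>A. f i) g = (\<Sum>i\<in>A. cinner (f i) g)"
  by (induction A rule: infinite_finite_induct) (auto simp: cinner_add_left)

lemma cinner_sum_right: "cinner g (\<Sum>i\<in>A. f i) = (\<Sum>i\<in>A. cinner g (f i))"
  by (induction A rule: infinite_finite_induct) (auto simp: cinner_add_right)

lemma cinner_self_norm: "cinner f f = complex_of_real ((norm f)\<^sup>2)"
  by (simp add: cinner_self norm_ell2_def infsum_nonneg)

lemma norm_sq_infsum: "(norm f)\<^sup>2 = (\<Sum>\<^sub>\<infinity>x. (cmod (ell2_fun f x))\<^sup>2)"
  by (simp add: norm_ell2_def infsum_nonneg)

lemma norm_sq_add:
  fixes f g :: "'a ell2"
  shows "(norm (f + g))\<^sup>2 = (norm f)\<^sup>2 + (norm g)\<^sup>2 + 2 * Re (cinner f g)"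
  unfolding power2_norm_eq_inner inner_ell2_def[symmetric]
  by (simp add: inner_add inner_commute)

lemma cinner_Cauchy_Schwarz: "cmod (cinner f g) \<le> norm f * norm g"
proof (cases "cinner f g = 0")
  case False
  define c where "c = cnj (cinner f g) / complex_of_real (cmod (cinner f g))"
  have c: "cmod c = 1"
    using False by (simp add: c_def norm_divide)
  have "c * cinner f g = complex_of_real (cmod (cinner f g))"
    using False by (simp add: c_def complex_norm_square[symmetric] mult.commute power2_eq_square)
  then have "cmod (cinner f g) = inner (c *\<^sub>C f) g"
    by (simp add: inner_ell2_def cinner_scaleC_left)
  also have "\<dots> \<le> norm (c *\<^sub>C f) * norm g"
    by (rule norm_cauchy_schwarz)
  finally show ?thesis
    by (simp add: norm_scaleC c)
qed simp

lemma bounded_linear_cinner_right: "bounded_linear (\<lambda>f. cinner g f)"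
  by (rule bounded_linear_intro[where K = "norm g"])
    (auto simp: cinner_add_right scaleR_eq_scaleC cinner_scaleC_right scaleR_conv_of_real
      cinner_Cauchy_Schwarz mult.commute intro: order_trans[OF cinner_Cauchy_Schwarz])


section \<open>The standard basis\<close>

lift_definition ket :: "'a \<Rightarrow> 'a ell2" is "\<lambda>x y. if y = x then 1 else 0"
proof -
  fix x :: 'a
  have "(\<lambda>y. (cmod (if y = x then 1 else 0))\<^sup>2) summable_on {x}"
    by simp
  then show "(\<lambda>y. (cmod (if y = x then 1 else 0))\<^sup>2) summable_on UNIV"
    by (rule summable_on_cong_neutral[THEN iffD1, rotated -1]) auto
qed

lemma cinner_ket: "cinner f (ket x) = ell2_fun f x"
proof -
  have "cinner f (ket x) = (\<Sum>\<^sub>\<infinity>y\<in>{x}. ell2_fun f y * cnj (ell2_fun (ket x) y))"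
    unfolding cinner_def by (rule infsum_cong_neutral) (auto simp: ket.rep_eq)
  then show ?thesis by (simp add: ket.rep_eq)
qed

lemma cinner_ket_left: "cinner (ket x) f = cnj (ell2_fun f x)"
  by (metis cinner_commute cinner_ket)

lemma norm_ket [simp]: "norm (ket x) = 1"
proof -
  have "complex_of_real ((norm (ket x))\<^sup>2) = 1"
    by (simp add: cinner_self_norm[symmetric] cinner_ket ket.rep_eq del: of_real_power)
  then have "(norm (ket x))\<^sup>2 = 1"
    using of_real_eq_1_iff by blast
  then show ?thesis
    by (metis norm_ge_zero power2_eq_1_iff neg_0_le_iff_le not_one_le_zero)
qed

lemma ket_in_ell2_on: "x \<in> \<Gamma> \<Longrightarrow> ket x \<in> ell2_on \<Gamma>"
  by (auto simp: ell2_on_def ket.rep_eq)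

lemma ell2_on_add: "f \<in> ell2_on \<Gamma> \<Longrightarrow> g \<in> ell2_on \<Gamma> \<Longrightarrow> f + g \<in> ell2_on \<Gamma>"
  by (auto simp: ell2_on_def plus_ell2.rep_eq)

lemma ell2_on_scaleC: "f \<in> ell2_on \<Gamma> \<Longrightarrow> c *\<^sub>C f \<in> ell2_on \<Gamma>"
  by (auto simp: ell2_on_def scaleC.rep_eq)

lemma ell2_on_diff: "f \<in> ell2_on \<Gamma> \<Longrightarrow> g \<in> ell2_on \<Gamma> \<Longrightarrow> f - g \<in> ell2_on \<Gamma>"
  by (auto simp: ell2_on_def ell2_fun_diff)

text \<open>The tail of a summable series is small, so finite truncations of \<open>f\<close> converge to \<open>f\<close>.\<close>

lemma finite_truncation_approx:
  assumes "e > 0"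
  shows "\<exists>F. finite F \<and> norm (f - (\<Sum>x\<in>F. ell2_fun f x *\<^sub>C ket x)) < e"
proof -
  let ?s = "\<lambda>x. (cmod (ell2_fun f x))\<^sup>2"
  have "(?s has_sum (norm f)\<^sup>2) UNIV"
    unfolding norm_sq_infsum using ell2_summable by (rule has_sum_infsum)
  then have "(sum ?s \<longlongrightarrow> (norm f)\<^sup>2) (finite_subsets_at_top UNIV)"
    by (simp only: has_sum_def)
  then have "\<forall>\<^sub>F F in finite_subsets_at_top UNIV. dist (sum ?s F) ((norm f)\<^sup>2) < e\<^sup>2"
    by (rule tendstoD) (use assms in simp)
  then obtain F where F: "finite F" "dist (sum ?s F) ((norm f)\<^sup>2) < e\<^sup>2"
    unfolding eventually_finite_subsets_at_top by blast
  let ?g = "\<Sum>x\<in>F. ell2_fun f x *\<^sub>C ket x"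
  have fg: "cinner f ?g = complex_of_real (sum ?s F)"
    by (simp add: cinner_sum_right cinner_scaleC_right cinner_ket complex_norm_square mult.commute
        del: of_real_power)
  have g: "ell2_fun ?g x = (if x \<in> F then ell2_fun f x else 0)" for x
    using F(1) by (simp add: ell2_fun_sum scaleC.rep_eq ket.rep_eq if_distrib cong: if_cong)
  have "cinner h ?g = (\<Sum>x\<in>F. cnj (ell2_fun f x) * ell2_fun h x)" for h
    by (simp add: cinner_sum_right cinner_scaleC_right cinner_ket)
  then have "cinner ?g ?g = (\<Sum>x\<in>F. cnj (ell2_fun f x) * ell2_fun ?g x)" .
  also have "\<dots> = complex_of_real (sum ?s F)"
    unfolding of_real_sum
  proof (rule sum.cong)
    fix x assume "x \<in> F"
    then show "cnj (ell2_fun f x) * ell2_fun ?g x = complex_of_real (?s x)"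
      unfolding g complex_norm_square by simp
  qed simp
  finally have "cinner ?g ?g = complex_of_real (sum ?s F)" .
  then have "(norm ?g)\<^sup>2 = sum ?s F"
    by (metis cinner_self_norm of_real_eq_iff)
  then have "(norm (f - ?g))\<^sup>2 = (norm f)\<^sup>2 - sum ?s F"
    using norm_sq_add[of f "- ?g"] fg by (simp add: cinner_minus_right)
  also have "\<dots> < e\<^sup>2"
    using F(2) by (simp add: dist_real_def)
  finally have "norm (f - ?g) < e"
    using assms by (simp add: power2_less_imp_less)
  then show ?thesis using F(1) by blast
qed

text \<open>
  Finite linear combinations of the vectors \<open>ket x\<close> with \<open>x \<in> \<Gamma>\<close> are dense in \<open>ell2_on \<Gamma>\<close>.
\<close>

lemma bounded_linear_eq_0_on_ell2_on:
  fixes G :: "'a ell2 \<Rightarrow> 'c::real_normed_vector"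
  assumes "bounded_linear G" "\<And>x c. x \<in> \<Gamma> \<Longrightarrow> G (c *\<^sub>C ket x) = 0" "f \<in> ell2_on \<Gamma>"
  shows "G f = 0"
proof (rule ccontr)
  interpret bounded_linear G by fact
  assume nz: "G f \<noteq> 0"
  obtain K where K: "K > 0" "\<And>g. norm (G g) \<le> norm g * K"
    using pos_bounded by blast
  obtain F where F: "norm (f - (\<Sum>x\<in>F. ell2_fun f x *\<^sub>C ket x)) < norm (G f) / K"
    using finite_truncation_approx[of "norm (G f) / K" f] nz K(1) by auto
  have z: "G (ell2_fun f x *\<^sub>C ket x) = 0" for x
    using assms(2,3) by (cases "x \<in> \<Gamma>") (auto simp: ell2_on_def zero)
  then have "G f = G (f - (\<Sum>x\<in>F. ell2_fun f x *\<^sub>C ket x))"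
    by (simp add: diff sum)
  then have "norm (G f) \<le> norm (f - (\<Sum>x\<in>F. ell2_fun f x *\<^sub>C ket x)) * K"
    using K(2) by metis
  also have "\<dots> < norm (G f)"
    using F K(1) by (simp add: pos_less_divide_eq)
  finally show False by simp
qed

text \<open>
  A nonnegative sesquilinear form satisfies the Cauchy-Schwarz inequality, so a vector on which it
  vanishes is in its kernel. Hence it is enough to test it on the standard basis.
\<close>

lemma nonneg_form_eq_0:
  fixes D :: "'a ell2 \<Rightarrow> 'a ell2 \<Rightarrow> complex"
  assumes addl: "\<And>f g h. D (f + g) h = D f h + D g h"
    and addr: "\<And>f g h. D h (f + g) = D h f + D h g"
    and scl: "\<And>c f g. D (c *\<^sub>C f) g = c * D f g"
    and scr: "\<And>c f g. D f (c *\<^sub>C g) = cnj c * D f g"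
    and bdd: "\<And>f. bounded_linear (D f)"
    and pos: "\<And>f. f \<in> ell2_on \<Gamma> \<Longrightarrow> Im (D f f) = 0 \<and> 0 \<le> Re (D f f)"
    and null: "\<And>x. x \<in> \<Gamma> \<Longrightarrow> D (ket x) (ket x) = 0"
    and f: "f \<in> ell2_on \<Gamma>" and g: "g \<in> ell2_on \<Gamma>"
  shows "D f g = 0"
proof (rule bounded_linear_eq_0_on_ell2_on[OF bdd _ g])
  fix x c assume x: "x \<in> \<Gamma>"
  define p q where "p = D (ket x) f" and "q = D f (ket x)"
  have *: "Im (D f f + (c * p + cnj c * q)) = 0 \<and> 0 \<le> Re (D f f + (c * p + cnj c * q))" for c
    using pos[OF ell2_on_add[OF f ell2_on_scaleC[OF ket_in_ell2_on[OF x], of c]]]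
    by (simp add: addl addr scl scr null[OF x] p_def q_def algebra_simps)
  have imf: "Im (D f f) = 0"
    using pos[OF f] by simp
  have im: "Im (c * p + cnj c * q) = 0" for c
    using *[of c] imf by simp
  have re: "Re (c * p + cnj c * q) = 0" for c
  proof (rule ccontr)
    let ?r = "Re (c * p + cnj c * q)"
    assume nz: "?r \<noteq> 0"
    \<comment> \<open>With this multiple of \<open>c\<close> the form would take the value \<open>-1\<close>.\<close>
    define t where "t = - (Re (D f f) + 1) / ?r"
    have "Re (complex_of_real t * c * p + cnj (complex_of_real t * c) * q) = t * ?r"
      by (simp add: algebra_simps)
    then have "0 \<le> Re (D f f) + t * ?r"
      using *[of "complex_of_real t * c"] by simp
    then show False using nz by (simp add: t_def)
  qed
  have "p + q = 0"
    using re[of 1] im[of 1] by (simp add: complex_eq_iff)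
  moreover have "\<i> * p - \<i> * q = 0"
    using re[of \<i>] im[of \<i>] by (simp add: complex_eq_iff)
  ultimately have "q = 0"
    by (simp add: complex_eq_iff)
  then show "D f (c *\<^sub>C ket x) = 0"
    by (simp add: scr q_def)
qed


section \<open>Matrix norms and compressions to peaking vectors\<close>

lemma matrix_op_norm_upper:
  fixes A :: "nat \<Rightarrow> nat \<Rightarrow> ('a ell2 \<Rightarrow>\<^sub>L 'a ell2)"
  assumes "\<And>\<xi>. (\<Sum>j<n. (norm (\<xi> j))\<^sup>2) \<le> 1 \<Longrightarrow> (\<Sum>i<n. (norm (\<Sum>j<n. blinfun_apply (A i j) (\<xi> j)))\<^sup>2) \<le> B"
  shows "(matrix_op_norm n A)\<^sup>2 \<le> B"
proof -
  have B: "0 \<le> B"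
    using assms[of "\<lambda>_. 0"] by (simp add: blinfun.zero_right)
  have "matrix_op_norm n A \<le> sqrt B"
    unfolding matrix_op_norm_def
  proof (rule cSUP_least)
    show "{\<xi> :: nat \<Rightarrow> 'a ell2. (\<Sum>j<n. (norm (\<xi> j))\<^sup>2) \<le> 1} \<noteq> {}"
      by (auto intro!: exI[of _ "\<lambda>_. 0"])
  qed (auto intro!: assms)
  moreover have "0 \<le> matrix_op_norm n A"
    unfolding matrix_op_norm_def
    by (rule cSUP_upper2[OF matrix_op_norm_bdd_above, of "\<lambda>_. 0"]) (auto simp: blinfun.zero_right)
  ultimately show ?thesis
    using B power_mono[of "matrix_op_norm n A" "sqrt B" 2] by simp
qed

lemma matrix_op_norm_lower:
  fixes A :: "nat \<Rightarrow> nat \<Rightarrow> ('a ell2 \<Rightarrow>\<^sub>L 'a ell2)"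
  assumes "(\<Sum>j<n. (norm (\<xi> j))\<^sup>2) \<le> 1"
  shows "(\<Sum>i<n. (norm (\<Sum>j<n. blinfun_apply (A i j) (\<xi> j)))\<^sup>2) \<le> (matrix_op_norm n A)\<^sup>2"
proof -
  have "sqrt (\<Sum>i<n. (norm (\<Sum>j<n. blinfun_apply (A i j) (\<xi> j)))\<^sup>2) \<le> matrix_op_norm n A"
    unfolding matrix_op_norm_def
    by (rule cSUP_upper[OF _ matrix_op_norm_bdd_above]) (use assms in simp)
  then show ?thesis
    by (rule sqrt_le_D)
qed

lemma complete_isometry_norm:
  fixes A :: "nat \<Rightarrow> nat \<Rightarrow> ('a ell2 \<Rightarrow>\<^sub>L 'a ell2)"
  assumes "complete_isometry \<U> \<V> \<theta>" "\<And>i j. i < n \<Longrightarrow> j < n \<Longrightarrow> A i j \<in> \<U>"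
  shows "matrix_op_norm n (\<lambda>i j. \<theta> (A i j)) = matrix_op_norm n A"
  using assms unfolding complete_isometry_def by blast

lemma complete_isometry_bound:
  fixes A :: "nat \<Rightarrow> nat \<Rightarrow> ('a ell2 \<Rightarrow>\<^sub>L 'a ell2)"
  assumes "complete_isometry \<U> \<V> \<theta>" "\<And>i j. i < n \<Longrightarrow> j < n \<Longrightarrow> A i j \<in> \<U>"
    and "\<And>\<xi>. (\<Sum>j<n. (norm (\<xi> j))\<^sup>2) \<le> 1 \<Longrightarrow> (\<Sum>i<n. (norm (\<Sum>j<n. blinfun_apply (A i j) (\<xi> j)))\<^sup>2) \<le> B"
    and "(\<Sum>j<n. (norm (\<eta> j))\<^sup>2) \<le> 1"
  shows "(\<Sum>i<n. (norm (\<Sum>j<n. blinfun_apply (\<theta> (A i j)) (\<eta> j)))\<^sup>2) \<le> B"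
proof -
  have "(\<Sum>i<n. (norm (\<Sum>j<n. blinfun_apply (\<theta> (A i j)) (\<eta> j)))\<^sup>2) \<le> (matrix_op_norm n (\<lambda>i j. \<theta> (A i j)))\<^sup>2"
    by (rule matrix_op_norm_lower) fact
  also have "matrix_op_norm n (\<lambda>i j. \<theta> (A i j)) = matrix_op_norm n A"
    by (rule complete_isometry_norm) fact+
  also have "(matrix_op_norm n A)\<^sup>2 \<le> B"
    by (rule matrix_op_norm_upper) fact
  finally show ?thesis .
qed

lemma complete_isometry_contraction:
  assumes "complete_isometry \<U> \<V> \<theta>" "T \<in> \<U>" "\<And>\<xi>. norm (blinfun_apply T \<xi>) \<le> K * norm \<xi>"
  shows "norm (blinfun_apply (\<theta> T) \<eta>) \<le> K * norm \<eta>"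
proof (cases "\<eta> = 0")
  case False
  have K: "0 \<le> K"
    using order_trans[OF norm_ge_zero assms(3)[of "ket undefined"]] by simp
  let ?u = "(1 / norm \<eta>) *\<^sub>R \<eta>"
  have "(\<Sum>i<1::nat. (norm (\<Sum>j<1::nat. blinfun_apply (\<theta> T) ?u))\<^sup>2) \<le> K\<^sup>2"
  proof (rule complete_isometry_bound[OF assms(1), where A = "\<lambda>_ _. T" and n = 1 and \<eta> = "\<lambda>_. ?u"])
    fix \<xi> :: "nat \<Rightarrow> 'a ell2"
    assume "(\<Sum>j<1::nat. (norm (\<xi> j))\<^sup>2) \<le> 1"
    then have "norm (\<xi> 0) \<le> 1"
      by (simp add: power_le_one_iff)
    then have "norm (blinfun_apply T (\<xi> 0)) \<le> K"
      using assms(3)[of "\<xi> 0"] K mult_left_le[of "norm (\<xi> 0)" K] by linarith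
    then show "(\<Sum>i<1::nat. (norm (\<Sum>j<1::nat. blinfun_apply T (\<xi> j)))\<^sup>2) \<le> K\<^sup>2"
      by (simp add: power_mono)
  qed (use assms(2) False in auto)
  then have "norm (blinfun_apply (\<theta> T) ?u) \<le> K"
    using K by (simp add: power2_le_iff_abs_le)
  then show ?thesis
    using False by (simp add: blinfun.scaleR_right divide_simps mult.commute)
qed (simp add: blinfun.zero_right)

lemma matrix_column_bound:
  fixes T :: "nat \<Rightarrow> nat \<Rightarrow> ('a ell2 \<Rightarrow>\<^sub>L 'b ell2)"
  obtains C where "C \<ge> 1"
    "\<And>\<eta>. (\<Sum>i<m. (norm (\<Sum>j<n. blinfun_apply (T i j) (\<eta> j)))\<^sup>2) \<le> C * (\<Sum>j<n. (norm (\<eta> j))\<^sup>2)"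
proof
  let ?C = "1 + (\<Sum>i<m. \<Sum>j<n. (norm (T i j))\<^sup>2)"
  show "1 \<le> ?C" by (simp add: sum_nonneg)
  fix \<eta> :: "nat \<Rightarrow> 'a ell2"
  let ?E = "\<Sum>j<n. (norm (\<eta> j))\<^sup>2"
  have "(norm (\<Sum>j<n. blinfun_apply (T i j) (\<eta> j)))\<^sup>2 \<le> (\<Sum>j<n. (norm (T i j))\<^sup>2) * ?E" for i
  proof -
    have "norm (\<Sum>j<n. blinfun_apply (T i j) (\<eta> j)) \<le> (\<Sum>j<n. norm (T i j) * norm (\<eta> j))"
      by (rule sum_norm_le) (rule norm_blinfun)
    then have "(norm (\<Sum>j<n. blinfun_apply (T i j) (\<eta> j)))\<^sup>2 \<le> (\<Sum>j<n. norm (T i j) * norm (\<eta> j))\<^sup>2"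
      by (rule power_mono) simp
    also have "\<dots> \<le> (\<Sum>j<n. (norm (T i j))\<^sup>2) * ?E"
      by (rule Cauchy_Schwarz_ineq_sum)
    finally show ?thesis .
  qed
  then have "(\<Sum>i<m. (norm (\<Sum>j<n. blinfun_apply (T i j) (\<eta> j)))\<^sup>2) \<le> (\<Sum>i<m. (\<Sum>j<n. (norm (T i j))\<^sup>2) * ?E)"
    by (rule sum_mono)
  also have "\<dots> \<le> ?C * ?E"
    by (simp add: sum_distrib_right[symmetric] distrib_right sum_nonneg)
  finally show "(\<Sum>i<m. (norm (\<Sum>j<n. blinfun_apply (T i j) (\<eta> j)))\<^sup>2) \<le> ?C * ?E" .
qed

lemma norm_add_sq_le:
  fixes f g :: "'a::real_inner"
  assumes "t > 0"
  shows "(norm (f + g))\<^sup>2 \<le> (1 + t) * (norm f)\<^sup>2 + (1 + 1 / t) * (norm g)\<^sup>2"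
proof -
  have "0 \<le> (norm (sqrt t *\<^sub>R f - (1 / sqrt t) *\<^sub>R g))\<^sup>2"
    by simp
  also have "\<dots> = t * (norm f)\<^sup>2 + (1 / t) * (norm g)\<^sup>2 - 2 * inner f g"
    using assms unfolding power2_norm_eq_inner
    by (simp add: inner_diff inner_commute field_simps power2_eq_square[symmetric])
  finally have "2 * inner f g \<le> t * (norm f)\<^sup>2 + (1 / t) * (norm g)\<^sup>2"
    by simp
  moreover have "(norm (f + g))\<^sup>2 = (norm f)\<^sup>2 + (norm g)\<^sup>2 + 2 * inner f g"
    unfolding power2_norm_eq_inner by (simp add: inner_add inner_commute)
  ultimately show ?thesis by (simp add: algebra_simps)
qed

lemma operator_space_scale: "operator_space \<Gamma> \<U> \<Longrightarrow> T \<in> \<U> \<Longrightarrow> scale_op c T \<in> \<U>"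
  and operator_space_add: "operator_space \<Gamma> \<U> \<Longrightarrow> S \<in> \<U> \<Longrightarrow> T \<in> \<U> \<Longrightarrow> S + T \<in> \<U>"
  and operator_space_zero: "operator_space \<Gamma> \<U> \<Longrightarrow> 0 \<in> \<U>"
  and operator_space_linear: "operator_space \<Gamma> \<U> \<Longrightarrow> T \<in> \<U> \<Longrightarrow> blinfun_apply T (c *\<^sub>C f) = c *\<^sub>C blinfun_apply T f"
  by (auto simp: operator_space_def bounded_ops_def)

lemma operator_space_sum:
  "operator_space \<Gamma> \<U> \<Longrightarrow> (\<And>i. i \<in> A \<Longrightarrow> T i \<in> \<U>) \<Longrightarrow> (\<Sum>i\<in>A. T i) \<in> \<U>"
  by (induction A rule: infinite_finite_induct) (auto simp: operator_space_zero operator_space_add)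

lemma complete_isometry_add: "complete_isometry \<U> \<V> \<theta> \<Longrightarrow> S \<in> \<U> \<Longrightarrow> T \<in> \<U> \<Longrightarrow> \<theta> (S + T) = \<theta> S + \<theta> T"
  and complete_isometry_scale: "complete_isometry \<U> \<V> \<theta> \<Longrightarrow> T \<in> \<U> \<Longrightarrow> \<theta> (scale_op c T) = scale_op c (\<theta> T)"
  and complete_isometry_mem: "complete_isometry \<U> \<V> \<theta> \<Longrightarrow> T \<in> \<U> \<Longrightarrow> \<theta> T \<in> \<V>"
  by (auto simp: complete_isometry_def)

lemma complete_isometry_zero: "complete_isometry \<U> \<V> \<theta> \<Longrightarrow> 0 \<in> \<U> \<Longrightarrow> \<theta> 0 = 0"
  using complete_isometry_add[of \<U> \<V> \<theta> 0 0] by simp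

lemma complete_isometry_sum:
  assumes "complete_isometry \<U> \<V> \<theta>" "operator_space \<Gamma> \<U>" "\<And>i. i \<in> A \<Longrightarrow> T i \<in> \<U>"
  shows "\<theta> (\<Sum>i\<in>A. T i) = (\<Sum>i\<in>A. \<theta> (T i))"
  using assms(3)
  by (induction A rule: infinite_finite_induct)
    (auto simp: complete_isometry_zero[OF assms(1)] operator_space_zero[OF assms(2)]
      complete_isometry_add[OF assms(1)] operator_space_sum[OF assms(2)])

lemma sum_split_double: "(\<Sum>i<2 * n. f i) = (\<Sum>i<n. f i) + (\<Sum>i<n. f (n + i))" for n :: nat
proof -
  have "(\<Sum>i<2 * n. f i) = (\<Sum>i<n. f i) + (\<Sum>i=n..<2 * n. f i)"
    by (simp add: lessThan_atLeast0 sum.atLeastLessThan_concat)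
  also have "(\<Sum>i=n..<2 * n. f i) = (\<Sum>i<n. f (n + i))"
    using sum.shift_bounds_nat_ivl[of f 0 n n] by (simp add: lessThan_atLeast0 mult_2 add.commute)
  finally show ?thesis .
qed

locale unital_complete_isometry =
  fixes \<Gamma> :: "'a set" and \<Delta> :: "'b set" and \<U> \<V> \<theta>
  assumes dom: "unital_operator_space \<Gamma> \<U>" and cod: "unital_operator_space \<Delta> \<V>"
    and ci: "complete_isometry \<U> \<V> \<theta>"
    and unital: "\<theta> (id_op \<Gamma>) = id_op \<Delta>"
begin

lemma os: "operator_space \<Gamma> \<U>" and id_mem: "id_op \<Gamma> \<in> \<U>" and os': "operator_space \<Delta> \<V>"
  using dom cod by (auto simp: unital_operator_space_def)

text \<open>
  Consider the operator matrix with block row \<open>N diag(P j)\<close> above the block row \<open>T\<close>. On the domain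
  side, split a vector into its components along the \<open>v j\<close> and orthogonal to them. The orthogonal
  part is annihilated by the \<open>P j\<close>, so for large \<open>N\<close> the weight \<open>N\<^sup>2\<close> outweighs everything it
  contributes through \<open>T\<close>, and the squared norm of the matrix is at most \<open>N\<^sup>2 + K\<close> up to a small
  error. On the other side, evaluating the image matrix at the vectors \<open>a j *\<^sub>C w j\<close>, almost fixed
  by the \<open>\<theta> (P j)\<close>, already produces \<open>N\<^sup>2\<close> from the first block row, up to \<open>N\<^sup>2 \<epsilon>\<close>; so only \<open>K\<close>
  is left for the second.
\<close>

lemma column_compression_bound:
  fixes P :: "nat \<Rightarrow> ('a ell2 \<Rightarrow>\<^sub>L 'a ell2)"
  assumes P: "\<And>j. j < n \<Longrightarrow> P j \<in> \<U>"
    and Papp: "\<And>j \<xi>. j < n \<Longrightarrow> blinfun_apply (P j) \<xi> = cinner \<xi> (v j) *\<^sub>C v j"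
    and v: "\<And>j. j < n \<Longrightarrow> norm (v j) = 1"
    and T: "\<And>i j. i < n \<Longrightarrow> j < n \<Longrightarrow> T i j \<in> \<U>"
    and K: "0 \<le> K"
      "\<And>a. (\<Sum>i<n. (norm (\<Sum>j<n. a j *\<^sub>C blinfun_apply (T i j) (v j)))\<^sup>2) \<le> K * (\<Sum>j<n. (cmod (a j))\<^sup>2)"
    and \<delta>: "0 < \<delta>"
  obtains \<epsilon> where "0 < \<epsilon>"
    "\<And>w a. \<lbrakk>\<And>j. j < n \<Longrightarrow> norm (w j) \<le> 1;
       \<And>j. j < n \<Longrightarrow> 1 - \<epsilon> \<le> (norm (blinfun_apply (\<theta> (P j)) (w j)))\<^sup>2;
       (\<Sum>j<n. (cmod (a j))\<^sup>2) = 1\<rbrakk>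
     \<Longrightarrow> (\<Sum>i<n. (norm (\<Sum>j<n. a j *\<^sub>C blinfun_apply (\<theta> (T i j)) (w j)))\<^sup>2) \<le> K + \<delta>"
proof -
  obtain C where C: "C \<ge> 1"
    "\<And>\<eta>. (\<Sum>i<n. (norm (\<Sum>j<n. blinfun_apply (T i j) (\<eta> j)))\<^sup>2) \<le> C * (\<Sum>j<n. (norm (\<eta> j))\<^sup>2)"
    by (rule matrix_column_bound[where T = T and m = n and n = n]) (rule that)
  \<comment> \<open>The weight in the splitting \<open>(1 + t) \<parallel>f\<parallel>\<^sup>2 + (1 + 1 / t) \<parallel>g\<parallel>\<^sup>2\<close>; the cross terms then cost \<open>t K \<le> \<delta> / 2\<close>.\<close>
  define t where "t = \<delta> / (2 * (K + 1))"
  have t: "0 < t" "t * K \<le> \<delta> / 2"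
    using K(1) \<delta> by (auto simp: t_def field_simps)
  \<comment> \<open>Exactly the size at which \<open>N\<^sup>2\<close> absorbs the part orthogonal to the \<open>v j\<close>.\<close>
  define N where "N = sqrt ((1 + 1 / t) * C)"
  have N2: "N\<^sup>2 = (1 + 1 / t) * C"
    using t C(1) by (simp add: N_def)
  have N: "0 < N"
    unfolding N_def using t C(1) by (intro real_sqrt_gt_zero mult_pos_pos add_pos_pos) auto
  \<comment> \<open>Complete isometries see square matrices only, so the two block rows are completed by zero columns.\<close>
  define A where "A = (\<lambda>i j. if i < n then (if j = i then scale_op (complex_of_real N) (P i) else 0)
     else if j < n then T (i - n) j else 0)"
  have A: "A i j \<in> \<U>" if "i < 2 * n" "j < 2 * n" for i j
    using that by (auto simp: A_def P T operator_space_zero[OF os] operator_space_scale[OF os])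
  have \<theta>0: "\<theta> 0 = 0"
    using complete_isometry_zero[OF ci operator_space_zero[OF os]] .
  have top: "(\<Sum>j<2 * n. blinfun_apply (A i j) (\<xi> j)) = complex_of_real N *\<^sub>C blinfun_apply (P i) (\<xi> i)"
    if "i < n" for i \<xi>
  proof -
    have "(\<Sum>j<2 * n. blinfun_apply (A i j) (\<xi> j)) = (\<Sum>j<2 * n. if j = i then complex_of_real N *\<^sub>C blinfun_apply (P i) (\<xi> i) else 0)"
      by (rule sum.cong) (use that in \<open>auto simp: A_def\<close>)
    then show ?thesis using that by simp
  qed
  have bot: "(\<Sum>j<2 * n. blinfun_apply (A (n + i) j) (\<xi> j)) = (\<Sum>j<n. blinfun_apply (T i j) (\<xi> j))" for i \<xi>
    by (simp add: sum_split_double A_def)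
  have top': "(\<Sum>j<2 * n. blinfun_apply (\<theta> (A i j)) (\<xi> j)) = complex_of_real N *\<^sub>C blinfun_apply (\<theta> (P i)) (\<xi> i)"
    if "i < n" for i \<xi>
  proof -
    have "(\<Sum>j<2 * n. blinfun_apply (\<theta> (A i j)) (\<xi> j)) = (\<Sum>j<2 * n. if j = i then complex_of_real N *\<^sub>C blinfun_apply (\<theta> (P i)) (\<xi> i) else 0)"
      by (rule sum.cong) (use that in \<open>auto simp: A_def \<theta>0 complete_isometry_scale[OF ci] P\<close>)
    then show ?thesis using that by simp
  qed
  have bot': "(\<Sum>j<2 * n. blinfun_apply (\<theta> (A (n + i) j)) (\<xi> j)) = (\<Sum>j<n. blinfun_apply (\<theta> (T i j)) (\<xi> j))" for i \<xi>
    by (simp add: sum_split_double A_def \<theta>0)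
  have upper: "(\<Sum>i<2 * n. (norm (\<Sum>j<2 * n. blinfun_apply (A i j) (\<xi> j)))\<^sup>2) \<le> N\<^sup>2 + K + \<delta> / 2"
    if "(\<Sum>j<2 * n. (norm (\<xi> j))\<^sup>2) \<le> 1" for \<xi>
  proof -
    define a where "a = (\<lambda>j. cinner (\<xi> j) (v j))"
    define \<eta> where "\<eta> = (\<lambda>j. \<xi> j - a j *\<^sub>C v j)"
    let ?\<alpha> = "\<Sum>j<n. (cmod (a j))\<^sup>2" and ?\<beta> = "\<Sum>j<n. (norm (\<eta> j))\<^sup>2"
    have pyth: "(norm (\<xi> j))\<^sup>2 = (cmod (a j))\<^sup>2 + (norm (\<eta> j))\<^sup>2" if "j < n" for j
    proof -
      have "cinner (v j) (v j) = 1"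
        using v[OF that] by (simp add: cinner_self_norm)
      then have "cinner (a j *\<^sub>C v j) (\<eta> j) = 0"
        unfolding \<eta>_def by (simp add: cinner_scaleC_left cinner_scaleC_right cinner_diff_right)
          (simp add: a_def cinner_commute[of "v j" "\<xi> j"])
      then have "(norm (a j *\<^sub>C v j + \<eta> j))\<^sup>2 = (norm (a j *\<^sub>C v j))\<^sup>2 + (norm (\<eta> j))\<^sup>2"
        by (simp add: norm_sq_add)
      then show ?thesis
        by (simp add: norm_scaleC v[OF that]) (simp add: \<eta>_def)
    qed
    have "?\<alpha> + ?\<beta> = (\<Sum>j<n. (norm (\<xi> j))\<^sup>2)"
      by (simp add: sum.distrib[symmetric] pyth)
    also have "\<dots> \<le> (\<Sum>j<2 * n. (norm (\<xi> j))\<^sup>2)"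
      by (simp add: sum_split_double sum_nonneg)
    finally have \<alpha>\<beta>: "?\<alpha> + ?\<beta> \<le> 1"
      using that by linarith
    have \<alpha>: "0 \<le> ?\<alpha>" and \<beta>: "0 \<le> ?\<beta>"
      by (simp_all add: sum_nonneg)
    define f where "f = (\<lambda>i. \<Sum>j<n. a j *\<^sub>C blinfun_apply (T i j) (v j))"
    define g where "g = (\<lambda>i. \<Sum>j<n. blinfun_apply (T i j) (\<eta> j))"
    have fg: "(\<Sum>j<n. blinfun_apply (T i j) (\<xi> j)) = f i + g i" if "i < n" for i
      unfolding f_def g_def sum.distrib[symmetric]
    proof (rule sum.cong)
      fix j assume "j \<in> {..<n}"
      then show "blinfun_apply (T i j) (\<xi> j) = a j *\<^sub>C blinfun_apply (T i j) (v j) + blinfun_apply (T i j) (\<eta> j)"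
        using operator_space_linear[OF os T[OF that, of j], of "a j" "v j"]
        by (simp add: \<eta>_def blinfun.diff_right)
    qed simp
    have "(\<Sum>i<2 * n. (norm (\<Sum>j<2 * n. blinfun_apply (A i j) (\<xi> j)))\<^sup>2)
        = (\<Sum>i<n. (norm (complex_of_real N *\<^sub>C blinfun_apply (P i) (\<xi> i)))\<^sup>2) + (\<Sum>i<n. (norm (f i + g i))\<^sup>2)"
      unfolding sum_split_double[where f = "\<lambda>i. (norm (\<Sum>j<2 * n. blinfun_apply (A i j) (\<xi> j)))\<^sup>2"]
      by (simp add: top bot fg)
    also have "(\<Sum>i<n. (norm (complex_of_real N *\<^sub>C blinfun_apply (P i) (\<xi> i)))\<^sup>2) = N\<^sup>2 * ?\<alpha>"
      by (simp add: Papp norm_scaleC norm_mult v power_mult_distrib sum_distrib_left a_def)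
    also have "(\<Sum>i<n. (norm (f i + g i))\<^sup>2) \<le> (\<Sum>i<n. (1 + t) * (norm (f i))\<^sup>2 + (1 + 1 / t) * (norm (g i))\<^sup>2)"
      by (intro sum_mono norm_add_sq_le t)
    also have "\<dots> = (1 + t) * (\<Sum>i<n. (norm (f i))\<^sup>2) + (1 + 1 / t) * (\<Sum>i<n. (norm (g i))\<^sup>2)"
      by (simp add: sum.distrib sum_distrib_left)
    also have "(1 + t) * (\<Sum>i<n. (norm (f i))\<^sup>2) \<le> (1 + t) * (K * ?\<alpha>)"
      unfolding f_def using t by (intro mult_left_mono K(2)) auto
    also have "(1 + 1 / t) * (\<Sum>i<n. (norm (g i))\<^sup>2) \<le> (1 + 1 / t) * (C * ?\<beta>)"
      unfolding g_def using t by (intro mult_left_mono C(2)) auto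
    also have "N\<^sup>2 * ?\<alpha> + ((1 + t) * (K * ?\<alpha>) + (1 + 1 / t) * (C * ?\<beta>))
        = N\<^sup>2 * (?\<alpha> + ?\<beta>) + K * ?\<alpha> + (t * K) * ?\<alpha>"
      by (simp add: N2 algebra_simps)
    also have "\<dots> \<le> N\<^sup>2 * 1 + K * 1 + \<delta> / 2 * 1"
      using \<alpha>\<beta> \<alpha> \<beta> t K(1) \<delta> by (intro add_mono mult_mono) auto
    finally show ?thesis by simp
  qed
  show thesis
  proof (rule that[of "\<delta> / (2 * N\<^sup>2)"])
    show "0 < \<delta> / (2 * N\<^sup>2)"
      using \<delta> N by simp
    fix w :: "nat \<Rightarrow> 'b ell2" and a :: "nat \<Rightarrow> complex"
    assume w1: "\<And>j. j < n \<Longrightarrow> norm (w j) \<le> 1"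
      and w2: "\<And>j. j < n \<Longrightarrow> 1 - \<delta> / (2 * N\<^sup>2) \<le> (norm (blinfun_apply (\<theta> (P j)) (w j)))\<^sup>2"
      and a: "(\<Sum>j<n. (cmod (a j))\<^sup>2) = 1"
    define \<xi> where "\<xi> = (\<lambda>j. if j < n then a j *\<^sub>C w j else 0)"
    have "(\<Sum>j<2 * n. (norm (\<xi> j))\<^sup>2) = (\<Sum>j<n. (cmod (a j))\<^sup>2 * (norm (w j))\<^sup>2)"
      by (simp add: sum_split_double \<xi>_def norm_scaleC power_mult_distrib)
    also have "\<dots> \<le> (\<Sum>j<n. (cmod (a j))\<^sup>2 * 1)"
      by (intro sum_mono mult_left_mono) (auto simp: w1 power_le_one)
    finally have \<xi>1: "(\<Sum>j<2 * n. (norm (\<xi> j))\<^sup>2) \<le> 1"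
      using a by simp
    have "(\<Sum>i<2 * n. (norm (\<Sum>j<2 * n. blinfun_apply (\<theta> (A i j)) (\<xi> j)))\<^sup>2) \<le> N\<^sup>2 + K + \<delta> / 2"
      by (rule complete_isometry_bound[OF ci A upper \<xi>1])
    moreover have "(\<Sum>i<2 * n. (norm (\<Sum>j<2 * n. blinfun_apply (\<theta> (A i j)) (\<xi> j)))\<^sup>2)
        = (\<Sum>i<n. (norm (complex_of_real N *\<^sub>C blinfun_apply (\<theta> (P i)) (\<xi> i)))\<^sup>2)
          + (\<Sum>i<n. (norm (\<Sum>j<n. blinfun_apply (\<theta> (T i j)) (\<xi> j)))\<^sup>2)"
      unfolding sum_split_double[where f = "\<lambda>i. (norm (\<Sum>j<2 * n. blinfun_apply (\<theta> (A i j)) (\<xi> j)))\<^sup>2"]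
      by (simp add: top' bot')
    moreover have "N\<^sup>2 - \<delta> / 2 \<le> (\<Sum>i<n. (norm (complex_of_real N *\<^sub>C blinfun_apply (\<theta> (P i)) (\<xi> i)))\<^sup>2)"
    proof -
      have "N\<^sup>2 - \<delta> / 2 = N\<^sup>2 * (1 - \<delta> / (2 * N\<^sup>2)) * (\<Sum>i<n. (cmod (a i))\<^sup>2)"
        using N by (simp add: a field_simps)
      also have "\<dots> = (\<Sum>i<n. N\<^sup>2 * (cmod (a i))\<^sup>2 * (1 - \<delta> / (2 * N\<^sup>2)))"
        by (simp add: sum_distrib_left sum_distrib_right mult.assoc mult.left_commute mult.commute)
      also have "\<dots> \<le> (\<Sum>i<n. N\<^sup>2 * (cmod (a i))\<^sup>2 * (norm (blinfun_apply (\<theta> (P i)) (w i)))\<^sup>2)"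
        by (intro sum_mono mult_left_mono w2) auto
      also have "\<dots> = (\<Sum>i<n. (norm (complex_of_real N *\<^sub>C blinfun_apply (\<theta> (P i)) (\<xi> i)))\<^sup>2)"
        by (intro sum.cong) (simp_all add: \<xi>_def P complete_isometry_mem[OF ci]
            operator_space_linear[OF os'] norm_scaleC norm_mult power_mult_distrib)
      finally show ?thesis .
    qed
    moreover have "(\<Sum>j<n. blinfun_apply (\<theta> (T i j)) (\<xi> j)) = (\<Sum>j<n. a j *\<^sub>C blinfun_apply (\<theta> (T i j)) (w j))"
      if "i < n" for i
      by (intro sum.cong) (simp_all add: \<xi>_def that T complete_isometry_mem[OF ci] operator_space_linear[OF os'])
    ultimately show "(\<Sum>i<n. (norm (\<Sum>j<n. a j *\<^sub>C blinfun_apply (\<theta> (T i j)) (w j)))\<^sup>2) \<le> K + \<delta>"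
      by simp
  qed
qed


text \<open>
  Since \<open>\<parallel>M v + f\<parallel>\<^sup>2 = M\<^sup>2 \<parallel>v\<parallel>\<^sup>2 + 2 M Re \<langle>f, v\<rangle> + \<parallel>f\<parallel>\<^sup>2\<close>, the norm of \<open>M + T\<close> for large \<open>M\<close> reveals the
  real part of the quadratic form of \<open>T\<close>. As \<open>\<theta>\<close> is unital, the previous bound can be applied to
  \<open>T + M\<close>.
\<close>

lemma form_compression_bound:
  fixes P :: "nat \<Rightarrow> ('a ell2 \<Rightarrow>\<^sub>L 'a ell2)"
  assumes P: "\<And>j. j < n \<Longrightarrow> P j \<in> \<U>"
    and Papp: "\<And>j \<xi>. j < n \<Longrightarrow> blinfun_apply (P j) \<xi> = cinner \<xi> (v j) *\<^sub>C v j"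
    and v: "\<And>j. j < n \<Longrightarrow> norm (v j) = 1" "\<And>j. j < n \<Longrightarrow> v j \<in> ell2_on \<Gamma>"
    and T: "\<And>i j. i < n \<Longrightarrow> j < n \<Longrightarrow> T i j \<in> \<U>"
    and K: "\<And>a. Re (\<Sum>i<n. cnj (a i) * cinner (\<Sum>j<n. a j *\<^sub>C blinfun_apply (T i j) (v j)) (v i))
        \<le> K * (\<Sum>j<n. (cmod (a j))\<^sup>2)"
    and \<delta>: "0 < \<delta>"
  obtains \<epsilon> where "0 < \<epsilon>"
    "\<And>w a. \<lbrakk>\<And>j. j < n \<Longrightarrow> norm (w j) = 1; \<And>j. j < n \<Longrightarrow> w j \<in> ell2_on \<Delta>;
       \<And>j. j < n \<Longrightarrow> 1 - \<epsilon> \<le> (norm (blinfun_apply (\<theta> (P j)) (w j)))\<^sup>2;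
       (\<Sum>j<n. (cmod (a j))\<^sup>2) = 1\<rbrakk>
     \<Longrightarrow> Re (\<Sum>i<n. cnj (a i) * cinner (\<Sum>j<n. a j *\<^sub>C blinfun_apply (\<theta> (T i j)) (w j)) (w i)) \<le> K + \<delta>"
proof -
  obtain C where C: "C \<ge> 1"
    "\<And>\<eta>. (\<Sum>i<n. (norm (\<Sum>j<n. blinfun_apply (T i j) (\<eta> j)))\<^sup>2) \<le> C * (\<Sum>j<n. (norm (\<eta> j))\<^sup>2)"
    by (rule matrix_column_bound[where T = T and m = n and n = n]) (rule that)
  \<comment> \<open>The first summand keeps the bound \<open>K'\<close> below nonnegative, the second makes \<open>(C + 1) / (2 M) \<le> \<delta>\<close>.\<close>
  define M where "M = 2 * \<bar>K\<bar> + (C + 1) / (2 * \<delta>)"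
  have M: "0 < M" "2 * \<bar>K\<bar> \<le> M" "(C + 1) / (2 * \<delta>) \<le> M"
    using C(1) \<delta> by (auto simp: M_def add_nonneg_pos)
  define T' where "T' = (\<lambda>i j. T i j + (if j = i then scale_op (complex_of_real M) (id_op \<Gamma>) else 0))"
  have T': "T' i j \<in> \<U>" if "i < n" "j < n" for i j
    unfolding T'_def using that
    by (auto intro!: operator_space_add[OF os] T operator_space_scale[OF os] id_mem operator_space_zero[OF os])
  have \<theta>T': "\<theta> (T' i j) = \<theta> (T i j) + (if j = i then scale_op (complex_of_real M) (id_op \<Delta>) else 0)"
    if "i < n" "j < n" for i j
    unfolding T'_def using that
    by (auto simp: complete_isometry_add[OF ci] T operator_space_scale[OF os] id_mem operator_space_zero[OF os]
        complete_isometry_scale[OF ci] unital complete_isometry_zero[OF ci])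
  have shift: "(\<Sum>i<n. (norm (f i + (complex_of_real M * a i) *\<^sub>C u i))\<^sup>2)
      = M\<^sup>2 * (\<Sum>j<n. (cmod (a j))\<^sup>2) + 2 * M * Re (\<Sum>i<n. cnj (a i) * cinner (f i) (u i)) + (\<Sum>i<n. (norm (f i))\<^sup>2)"
    if "\<And>j. j < n \<Longrightarrow> norm (u j) = 1" for u f :: "nat \<Rightarrow> 'c ell2" and a
  proof -
    have "(norm (f i + (complex_of_real M * a i) *\<^sub>C u i))\<^sup>2
      = M\<^sup>2 * (cmod (a i))\<^sup>2 + 2 * M * Re (cnj (a i) * cinner (f i) (u i)) + (norm (f i))\<^sup>2" if "i < n" for i
      using \<open>\<And>j. j < n \<Longrightarrow> norm (u j) = 1\<close>[OF that]
      by (simp add: norm_sq_add norm_scaleC norm_mult power_mult_distrib cinner_scaleC_right mult.assoc)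
    then show ?thesis
      by (simp add: sum.distrib sum_distrib_left distrib_left)
  qed
  have expand: "(\<Sum>j<n. a j *\<^sub>C blinfun_apply (S j + (if j = i then scale_op (complex_of_real M) (id_op \<Omega>) else 0)) (u j))
      = (\<Sum>j<n. a j *\<^sub>C blinfun_apply (S j) (u j)) + (complex_of_real M * a i) *\<^sub>C u i"
    if "i < n" "u i \<in> ell2_on \<Omega>" for i a u S and \<Omega> :: "'c set"
  proof -
    have "(\<Sum>j<n. a j *\<^sub>C blinfun_apply (S j + (if j = i then scale_op (complex_of_real M) (id_op \<Omega>) else 0)) (u j))
      = (\<Sum>j<n. a j *\<^sub>C blinfun_apply (S j) (u j) + (if j = i then (complex_of_real M * a i) *\<^sub>C u i else 0))"
      by (rule sum.cong) (use that in \<open>auto simp: blinfun.add_left scaleC_add_right id_op_apply mult.commute\<close>)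
    then show ?thesis using that(1) by (simp add: sum.distrib)
  qed
  define K' where "K' = M\<^sup>2 + 2 * M * K + C"
  have K': "0 \<le> K'"
  proof -
    have "- (2 * K) * M \<le> M * M"
      using M by (intro mult_right_mono) auto
    then show ?thesis using C(1) by (simp add: K'_def power2_eq_square algebra_simps)
  qed
  have K'': "(\<Sum>i<n. (norm (\<Sum>j<n. a j *\<^sub>C blinfun_apply (T' i j) (v j)))\<^sup>2) \<le> K' * (\<Sum>j<n. (cmod (a j))\<^sup>2)" for a
  proof -
    let ?f = "\<lambda>i. \<Sum>j<n. a j *\<^sub>C blinfun_apply (T i j) (v j)"
    have "(\<Sum>i<n. (norm (\<Sum>j<n. a j *\<^sub>C blinfun_apply (T' i j) (v j)))\<^sup>2)
        = (\<Sum>i<n. (norm (?f i + (complex_of_real M * a i) *\<^sub>C v i))\<^sup>2)"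
      unfolding T'_def by (intro sum.cong) (simp_all only: expand v lessThan_iff)
    also have "\<dots> = M\<^sup>2 * (\<Sum>j<n. (cmod (a j))\<^sup>2) + 2 * M * Re (\<Sum>i<n. cnj (a i) * cinner (?f i) (v i)) + (\<Sum>i<n. (norm (?f i))\<^sup>2)"
      by (rule shift) (rule v)
    also have "\<dots> \<le> M\<^sup>2 * (\<Sum>j<n. (cmod (a j))\<^sup>2) + 2 * M * (K * (\<Sum>j<n. (cmod (a j))\<^sup>2)) + C * (\<Sum>j<n. (cmod (a j))\<^sup>2)"
    proof (intro add_mono mult_left_mono K order_refl)
      have "(\<Sum>i<n. (norm (?f i))\<^sup>2) = (\<Sum>i<n. (norm (\<Sum>j<n. blinfun_apply (T i j) (a j *\<^sub>C v j)))\<^sup>2)"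
        by (intro sum.cong arg_cong[where f = "\<lambda>z. (norm z)\<^sup>2"])
          (simp_all add: operator_space_linear[OF os] T)
      also have "\<dots> \<le> C * (\<Sum>j<n. (norm (a j *\<^sub>C v j))\<^sup>2)"
        by (rule C(2))
      finally show "(\<Sum>i<n. (norm (?f i))\<^sup>2) \<le> C * (\<Sum>j<n. (cmod (a j))\<^sup>2)"
        by (simp add: norm_scaleC v)
    qed (use M in auto)
    finally show ?thesis by (simp add: K'_def algebra_simps)
  qed
  obtain \<epsilon> where \<epsilon>: "0 < \<epsilon>"
    "\<And>w a. \<lbrakk>\<And>j. j < n \<Longrightarrow> norm (w j) \<le> 1;
       \<And>j. j < n \<Longrightarrow> 1 - \<epsilon> \<le> (norm (blinfun_apply (\<theta> (P j)) (w j)))\<^sup>2;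
       (\<Sum>j<n. (cmod (a j))\<^sup>2) = 1\<rbrakk>
     \<Longrightarrow> (\<Sum>i<n. (norm (\<Sum>j<n. a j *\<^sub>C blinfun_apply (\<theta> (T' i j)) (w j)))\<^sup>2) \<le> K' + 1"
    by (rule column_compression_bound[OF P Papp v(1) T' K' K'' zero_less_one]) blast+
  show thesis
  proof (rule that[OF \<epsilon>(1)])
    fix w :: "nat \<Rightarrow> 'b ell2" and a :: "nat \<Rightarrow> complex"
    assume w: "\<And>j. j < n \<Longrightarrow> norm (w j) = 1" "\<And>j. j < n \<Longrightarrow> w j \<in> ell2_on \<Delta>"
      "\<And>j. j < n \<Longrightarrow> 1 - \<epsilon> \<le> (norm (blinfun_apply (\<theta> (P j)) (w j)))\<^sup>2"
      and a: "(\<Sum>j<n. (cmod (a j))\<^sup>2) = 1"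
    let ?f = "\<lambda>i. \<Sum>j<n. a j *\<^sub>C blinfun_apply (\<theta> (T i j)) (w j)"
    let ?R = "Re (\<Sum>i<n. cnj (a i) * cinner (?f i) (w i))"
    have "(\<Sum>i<n. (norm (\<Sum>j<n. a j *\<^sub>C blinfun_apply (\<theta> (T' i j)) (w j)))\<^sup>2)
        = (\<Sum>i<n. (norm (?f i + (complex_of_real M * a i) *\<^sub>C w i))\<^sup>2)"
    proof (intro sum.cong refl)
      fix i assume "i \<in> {..<n}"
      then have i: "i < n" by simp
      have "(\<Sum>j<n. a j *\<^sub>C blinfun_apply (\<theta> (T' i j)) (w j))
          = (\<Sum>j<n. a j *\<^sub>C blinfun_apply (\<theta> (T i j) + (if j = i then scale_op (complex_of_real M) (id_op \<Delta>) else 0)) (w j))"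
        by (intro sum.cong) (simp_all only: \<theta>T' i lessThan_iff)
      then show "(norm (\<Sum>j<n. a j *\<^sub>C blinfun_apply (\<theta> (T' i j)) (w j)))\<^sup>2
          = (norm (?f i + (complex_of_real M * a i) *\<^sub>C w i))\<^sup>2"
        by (simp only: expand i w)
    qed
    also have "\<dots> = M\<^sup>2 * 1 + 2 * M * ?R + (\<Sum>i<n. (norm (?f i))\<^sup>2)"
      unfolding a[symmetric] by (rule shift) (rule w)
    finally have "M\<^sup>2 + 2 * M * ?R + (\<Sum>i<n. (norm (?f i))\<^sup>2) \<le> M\<^sup>2 + 2 * M * K + C + 1"
      using \<epsilon>(2)[of w a] w a by (simp add: K'_def)
    moreover have "0 \<le> (\<Sum>i<n. (norm (?f i))\<^sup>2)"
      by (simp add: sum_nonneg)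
    ultimately have "2 * M * ?R \<le> 2 * M * K + (C + 1)"
      by linarith
    also have "C + 1 \<le> 2 * M * \<delta>"
      using M(3) \<delta> by (simp add: field_simps)
    finally have "2 * M * ?R \<le> 2 * M * (K + \<delta>)"
      by (simp add: algebra_simps)
    then show "?R \<le> K + \<delta>"
      using M(1) by simp
  qed
qed

text \<open>
  For vectors fixed by the \<open>\<theta> (P j)\<close>, every \<open>\<epsilon>\<close> is admissible and the error disappears.
\<close>

lemma form_compression_le:
  fixes P :: "nat \<Rightarrow> ('a ell2 \<Rightarrow>\<^sub>L 'a ell2)"
  assumes P: "\<And>j. j < n \<Longrightarrow> P j \<in> \<U>"
    and Papp: "\<And>j \<xi>. j < n \<Longrightarrow> blinfun_apply (P j) \<xi> = cinner \<xi> (v j) *\<^sub>C v j"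
    and v: "\<And>j. j < n \<Longrightarrow> norm (v j) = 1" "\<And>j. j < n \<Longrightarrow> v j \<in> ell2_on \<Gamma>"
    and T: "\<And>i j. i < n \<Longrightarrow> j < n \<Longrightarrow> T i j \<in> \<U>"
    and K: "\<And>a. Re (\<Sum>i<n. cnj (a i) * cinner (\<Sum>j<n. a j *\<^sub>C blinfun_apply (T i j) (v j)) (v i))
        \<le> K * (\<Sum>j<n. (cmod (a j))\<^sup>2)"
    and w: "\<And>j. j < n \<Longrightarrow> norm (w j) = 1" "\<And>j. j < n \<Longrightarrow> w j \<in> ell2_on \<Delta>"
      "\<And>j. j < n \<Longrightarrow> blinfun_apply (\<theta> (P j)) (w j) = w j"
    and a: "(\<Sum>j<n. (cmod (a j))\<^sup>2) = 1"
  shows "Re (\<Sum>i<n. cnj (a i) * cinner (\<Sum>j<n. a j *\<^sub>C blinfun_apply (\<theta> (T i j)) (w j)) (w i)) \<le> K"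
proof (rule field_le_epsilon)
  fix \<delta> :: real assume \<delta>: "0 < \<delta>"
  obtain \<epsilon> where \<epsilon>: "0 < \<epsilon>"
    "\<And>w a. \<lbrakk>\<And>j. j < n \<Longrightarrow> norm (w j) = 1; \<And>j. j < n \<Longrightarrow> w j \<in> ell2_on \<Delta>;
       \<And>j. j < n \<Longrightarrow> 1 - \<epsilon> \<le> (norm (blinfun_apply (\<theta> (P j)) (w j)))\<^sup>2;
       (\<Sum>j<n. (cmod (a j))\<^sup>2) = 1\<rbrakk>
     \<Longrightarrow> Re (\<Sum>i<n. cnj (a i) * cinner (\<Sum>j<n. a j *\<^sub>C blinfun_apply (\<theta> (T i j)) (w j)) (w i)) \<le> K + \<delta>"
    by (rule form_compression_bound[OF P Papp v T K \<delta>]) blast+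
  show "Re (\<Sum>i<n. cnj (a i) * cinner (\<Sum>j<n. a j *\<^sub>C blinfun_apply (\<theta> (T i j)) (w j)) (w i)) \<le> K + \<delta>"
    by (rule \<epsilon>(2)) (use \<epsilon>(1) w a in auto)
qed

text \<open>
  The approximate form for a single projection is needed as long as it is unknown whether
  \<open>\<theta> P\<close> attains its norm.
\<close>

lemma peak_norm_le:
  assumes P: "P \<in> \<U>" "\<And>\<xi>. blinfun_apply P \<xi> = cinner \<xi> v *\<^sub>C v" "norm v = 1"
    and T: "T \<in> \<U>" and \<delta>: "0 < \<delta>"
  obtains \<epsilon> where "0 < \<epsilon>"
    "\<And>w. \<lbrakk>norm w = 1; 1 - \<epsilon> \<le> (norm (blinfun_apply (\<theta> P) w))\<^sup>2\<rbrakk>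
     \<Longrightarrow> (norm (blinfun_apply (\<theta> T) w))\<^sup>2 \<le> (norm (blinfun_apply T v))\<^sup>2 + \<delta>"
proof -
  obtain \<epsilon> where \<epsilon>: "0 < \<epsilon>"
    "\<And>w a. \<lbrakk>\<And>j. j < 1 \<Longrightarrow> norm (w j) \<le> 1;
       \<And>j. j < 1 \<Longrightarrow> 1 - \<epsilon> \<le> (norm (blinfun_apply (\<theta> P) (w j)))\<^sup>2;
       (\<Sum>j<1::nat. (cmod (a j))\<^sup>2) = 1\<rbrakk>
     \<Longrightarrow> (\<Sum>i<1::nat. (norm (\<Sum>j<1::nat. a j *\<^sub>C blinfun_apply (\<theta> T) (w j)))\<^sup>2) \<le> (norm (blinfun_apply T v))\<^sup>2 + \<delta>"
    by (rule column_compression_bound[of 1 "\<lambda>_. P" "\<lambda>_. v" "\<lambda>_ _. T" "(norm (blinfun_apply T v))\<^sup>2" \<delta>])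
      (use assms in \<open>auto simp: norm_scaleC power_mult_distrib mult.commute\<close>)
  show thesis
    by (rule that[OF \<epsilon>(1)]) (use \<epsilon>(2)[of "\<lambda>_. w" "\<lambda>_. 1" for w] in auto)
qed

lemma peak_form_le:
  assumes P: "P \<in> \<U>" "\<And>\<xi>. blinfun_apply P \<xi> = cinner \<xi> v *\<^sub>C v" "norm v = 1" "v \<in> ell2_on \<Gamma>"
    and T: "T \<in> \<U>" and \<delta>: "0 < \<delta>"
  obtains \<epsilon> where "0 < \<epsilon>"
    "\<And>w. \<lbrakk>norm w = 1; w \<in> ell2_on \<Delta>; 1 - \<epsilon> \<le> (norm (blinfun_apply (\<theta> P) w))\<^sup>2\<rbrakk>
     \<Longrightarrow> Re (cinner (blinfun_apply (\<theta> T) w) w) \<le> Re (cinner (blinfun_apply T v) v) + \<delta>"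
proof -
  obtain \<epsilon> where \<epsilon>: "0 < \<epsilon>"
    "\<And>w a. \<lbrakk>\<And>j. j < 1 \<Longrightarrow> norm (w j) = 1; \<And>j. j < 1 \<Longrightarrow> w j \<in> ell2_on \<Delta>;
       \<And>j. j < 1 \<Longrightarrow> 1 - \<epsilon> \<le> (norm (blinfun_apply (\<theta> P) (w j)))\<^sup>2;
       (\<Sum>j<1::nat. (cmod (a j))\<^sup>2) = 1\<rbrakk>
     \<Longrightarrow> Re (\<Sum>i<1::nat. cnj (a i) * cinner (\<Sum>j<1::nat. a j *\<^sub>C blinfun_apply (\<theta> T) (w j)) (w i))
        \<le> Re (cinner (blinfun_apply T v) v) + \<delta>"
  proof (rule form_compression_bound[of 1 "\<lambda>_. P" "\<lambda>_. v" "\<lambda>_ _. T" "Re (cinner (blinfun_apply T v) v)" \<delta>])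
    fix a :: "nat \<Rightarrow> complex"
    show "Re (\<Sum>i<1::nat. cnj (a i) * cinner (\<Sum>j<1::nat. a j *\<^sub>C blinfun_apply T v) v)
        \<le> Re (cinner (blinfun_apply T v) v) * (\<Sum>j<1. (cmod (a j))\<^sup>2)"
      by (simp add: cinner_scaleC_left cmod_power2) (simp add: algebra_simps power2_eq_square)
  qed (use assms in auto)
  show thesis
    by (rule that[OF \<epsilon>(1)]) (use \<epsilon>(2)[of "\<lambda>_. w" "\<lambda>_. 1" for w] in auto)
qed

text \<open>
  Applying the inequality of real parts to \<open>c T\<close> for \<open>c = 1, -1, \<i>, -\<i>\<close> gives equality.
\<close>

lemma peak_form_eq:
  assumes P: "P \<in> \<U>" "\<And>\<xi>. blinfun_apply P \<xi> = cinner \<xi> v *\<^sub>C v" "norm v = 1" "v \<in> ell2_on \<Gamma>"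
    and w: "norm w = 1" "w \<in> ell2_on \<Delta>" "blinfun_apply (\<theta> P) w = w"
    and T: "T \<in> \<U>"
  shows "cinner (blinfun_apply (\<theta> T) w) w = cinner (blinfun_apply T v) v"
proof -
  have le: "Re (cinner (blinfun_apply (\<theta> S) w) w) \<le> Re (cinner (blinfun_apply S v) v)" if S: "S \<in> \<U>" for S
  proof (rule field_le_epsilon)
    fix \<delta> :: real assume "0 < \<delta>"
    with P S obtain \<epsilon> where \<epsilon>: "0 < \<epsilon>"
      "\<And>w. \<lbrakk>norm w = 1; w \<in> ell2_on \<Delta>; 1 - \<epsilon> \<le> (norm (blinfun_apply (\<theta> P) w))\<^sup>2\<rbrakk>
     \<Longrightarrow> Re (cinner (blinfun_apply (\<theta> S) w) w) \<le> Re (cinner (blinfun_apply S v) v) + \<delta>"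
      by (rule peak_form_le) (rule that)
    show "Re (cinner (blinfun_apply (\<theta> S) w) w) \<le> Re (cinner (blinfun_apply S v) v) + \<delta>"
      by (rule \<epsilon>(2)) (use \<epsilon>(1) w in auto)
  qed
  have "Re (c * cinner (blinfun_apply (\<theta> T) w) w) \<le> Re (c * cinner (blinfun_apply T v) v)" for c
    using le[OF operator_space_scale[OF os T, of c]]
    by (simp add: complete_isometry_scale[OF ci T] cinner_scaleC_left)
  from this[of 1] this[of "-1"] this[of \<i>] this[of "-\<i>"] show ?thesis
    by (simp add: complex_eq_iff)
qed

end


section \<open>Images of the coordinate projections\<close>

definition ket_proj :: "'a set \<Rightarrow> 'a \<Rightarrow> ('a ell2 \<Rightarrow>\<^sub>L 'a ell2)" where
  "ket_proj \<Gamma> x = mult_op \<Gamma> (\<lambda>t. if t = x then 1 else 0)"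

lemma bounded_if_range: "bounded ((\<lambda>t. if t = x then a else b) ` A)"
  by (rule finite_imp_bounded, rule finite_subset[of _ "{a, b}"]) auto

lemma ket_proj_apply:
  assumes "x \<in> \<Gamma>"
  shows "blinfun_apply (ket_proj \<Gamma> x) \<xi> = cinner \<xi> (ket x) *\<^sub>C ket x"
  by (rule ell2_eqI)
    (use assms in \<open>auto simp: ket_proj_def mult_op_apply[OF bounded_if_range] scaleC.rep_eq ket.rep_eq cinner_ket\<close>)

lemma ket_proj_mem: "ket_proj \<Gamma> x \<in> linfty_ops \<Gamma>"
  unfolding ket_proj_def linfty_ops_def by (intro CollectI exI[of _ "\<lambda>t. if t = x then 1 else 0"] conjI refl bounded_if_range)

lemma ell2_fun_id_op: "ell2_fun (blinfun_apply (id_op \<Gamma>) f) x = (if x \<in> \<Gamma> then ell2_fun f x else 0)"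
  by (auto simp: id_op_def mult_op_apply image_constant_conv)

lemma id_op_in_ell2_on: "blinfun_apply (id_op \<Gamma>) f \<in> ell2_on \<Gamma>"
  by (simp add: ell2_on_def ell2_fun_id_op)

lemma norm_ell2_mono:
  assumes "\<And>x. cmod (ell2_fun f x) \<le> cmod (ell2_fun g x)"
  shows "norm f \<le> norm g"
  unfolding norm_ell2_def
  by (intro real_sqrt_le_mono infsum_mono ell2_summable power_mono assms) auto

lemma norm_id_op_le: "norm (blinfun_apply (id_op \<Gamma>) f) \<le> norm f"
  by (rule norm_ell2_mono) (simp add: ell2_fun_id_op)

lemma operator_space_range: "operator_space \<Gamma> \<U> \<Longrightarrow> T \<in> \<U> \<Longrightarrow> blinfun_apply T f \<in> ell2_on \<Gamma>"
  by (auto simp: operator_space_def bounded_ops_def)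

lemma operator_space_id_op:
  assumes "operator_space \<Gamma> \<U>" "T \<in> \<U>"
  shows "blinfun_apply T (blinfun_apply (id_op \<Gamma>) f) = blinfun_apply T f"
proof -
  have "f - blinfun_apply (id_op \<Gamma>) f \<in> ell2_on (- \<Gamma>)"
    by (simp add: ell2_on_def ell2_fun_diff ell2_fun_id_op)
  then have "blinfun_apply T (f - blinfun_apply (id_op \<Gamma>) f) = 0"
    using assms unfolding operator_space_def bounded_ops_def by blast
  then show ?thesis by (simp add: blinfun.diff_right)
qed

lemma cinner_id_op:
  assumes "g \<in> ell2_on \<Gamma>"
  shows "cinner (blinfun_apply (id_op \<Gamma>) f) g = cinner f g"
  unfolding cinner_def
  by (rule infsum_cong) (use assms in \<open>auto simp: ell2_fun_id_op ell2_on_def\<close>)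

text \<open>
  The operator \<open>p + z (1 - p)\<close>, written as \<open>(1 - z) p + z\<close>, is a diagonal unitary on \<open>\<ell>\<^sup>2(\<Gamma>)\<close>.
\<close>

lemma norm_ket_rotation_le:
  assumes "x \<in> \<Gamma>" "cmod z = 1"
  shows "norm (blinfun_apply (scale_op (1 - z) (ket_proj \<Gamma> x) + scale_op z (id_op \<Gamma>)) \<xi>) \<le> 1 * norm \<xi>"
  unfolding mult_1
proof (rule norm_ell2_mono)
  fix t
  have "ell2_fun (blinfun_apply (scale_op (1 - z) (ket_proj \<Gamma> x) + scale_op z (id_op \<Gamma>)) \<xi>) t
      = (if t = x then ell2_fun \<xi> t else if t \<in> \<Gamma> then z * ell2_fun \<xi> t else 0)"
    using assms(1)
    by (simp add: blinfun.add_left ket_proj_apply plus_ell2.rep_eq scaleC.rep_eq cinner_ket ket.rep_eq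
        ell2_fun_id_op algebra_simps)
  then show "cmod (ell2_fun (blinfun_apply (scale_op (1 - z) (ket_proj \<Gamma> x) + scale_op z (id_op \<Gamma>)) \<xi>) t) \<le> cmod (ell2_fun \<xi> t)"
    using assms(2) by (simp add: norm_mult)
qed

text \<open>
  Otherwise \<open>T\<close>, and therefore \<open>\<theta> T\<close>, would have norm less than one.
\<close>

lemma (in unital_complete_isometry) norming_vector:
  assumes T: "T \<in> \<U>" and w: "norm w = 1" "norm (blinfun_apply (\<theta> T) w) = 1" and \<epsilon>: "0 < \<epsilon>"
  obtains \<xi> where "\<xi> \<in> ell2_on \<Gamma>" "norm \<xi> = 1" "1 - \<epsilon> \<le> (norm (blinfun_apply T \<xi>))\<^sup>2"
proof -
  \<comment> \<open>The minimum keeps the radicand nonnegative when \<open>\<epsilon> > 1\<close>.\<close>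
  define c where "c = sqrt (1 - min \<epsilon> 1)"
  have c: "0 \<le> c" "c < 1" "1 - \<epsilon> \<le> c\<^sup>2"
    using \<epsilon> by (auto simp: c_def)
  have "\<exists>\<xi>. c * norm \<xi> < norm (blinfun_apply T \<xi>)"
  proof (rule ccontr)
    assume "\<nexists>\<xi>. c * norm \<xi> < norm (blinfun_apply T \<xi>)"
    then have "norm (blinfun_apply (\<theta> T) w) \<le> c * norm w"
      by (intro complete_isometry_contraction[OF ci T]) (simp add: not_less)
    then show False using w c by simp
  qed
  then obtain \<xi> where \<xi>: "c * norm \<xi> < norm (blinfun_apply T \<xi>)" by blast
  define \<zeta> where "\<zeta> = blinfun_apply (id_op \<Gamma>) \<xi>"
  have T\<zeta>: "blinfun_apply T \<zeta> = blinfun_apply T \<xi>"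
    by (simp add: \<zeta>_def operator_space_id_op[OF os T])
  have "c * norm \<zeta> \<le> c * norm \<xi>"
    unfolding \<zeta>_def by (rule mult_left_mono[OF norm_id_op_le c(1)])
  with \<xi> T\<zeta> have \<zeta>: "c * norm \<zeta> < norm (blinfun_apply T \<zeta>)" by simp
  then have nz: "\<zeta> \<noteq> 0" by (auto simp: blinfun.zero_right)
  show thesis
  proof (rule that[of "complex_of_real (1 / norm \<zeta>) *\<^sub>C \<zeta>"])
    show "complex_of_real (1 / norm \<zeta>) *\<^sub>C \<zeta> \<in> ell2_on \<Gamma>"
      unfolding \<zeta>_def by (intro ell2_on_scaleC id_op_in_ell2_on)
    show "norm (complex_of_real (1 / norm \<zeta>) *\<^sub>C \<zeta>) = 1"
      using nz by (simp add: norm_scaleC norm_divide)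
    have "norm (blinfun_apply T (complex_of_real (1 / norm \<zeta>) *\<^sub>C \<zeta>)) = norm (blinfun_apply T \<zeta>) / norm \<zeta>"
      by (simp only: operator_space_linear[OF os T] norm_scaleC) (simp add: norm_divide)
    also have "c \<le> \<dots>"
      using \<zeta> nz by (simp add: field_simps)
    finally have "c\<^sup>2 \<le> (norm (blinfun_apply T (complex_of_real (1 / norm \<zeta>) *\<^sub>C \<zeta>)))\<^sup>2"
      using c(1) by (intro power_mono) auto
    with c(3) show "1 - \<epsilon> \<le> (norm (blinfun_apply T (complex_of_real (1 / norm \<zeta>) *\<^sub>C \<zeta>)))\<^sup>2"
      by linarith
  qed
qed

text \<open>
  The assumptions are symmetric in \<open>\<theta>\<close> and its inverse \<open>\<psi>\<close>, so that each result about \<open>\<theta>\<close> is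
  available for \<open>\<psi>\<close> as well.
\<close>

locale masa_isomorphism =
  fwd: unital_complete_isometry \<Gamma> \<Delta> \<U> \<V> \<theta> + bwd: unital_complete_isometry \<Delta> \<Gamma> \<V> \<U> \<psi>
  for \<Gamma> :: "'a set" and \<Delta> :: "'b set" and \<U> \<V> \<theta> \<psi> +
  assumes diag_dom: "linfty_ops \<Gamma> \<subseteq> \<U>" and diag_cod: "linfty_ops \<Delta> \<subseteq> \<V>"
    and inv_left: "T \<in> \<U> \<Longrightarrow> \<psi> (\<theta> T) = T" and inv_right: "S \<in> \<V> \<Longrightarrow> \<theta> (\<psi> S) = S"
begin

lemma swap: "masa_isomorphism \<Delta> \<Gamma> \<V> \<U> \<psi> \<theta>"
  by unfold_locales (use diag_dom diag_cod inv_left inv_right in auto)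

lemma ket_proj_mem_dom: "ket_proj \<Gamma> x \<in> \<U>" and ket_proj_mem_cod: "ket_proj \<Delta> y \<in> \<V>"
  by (rule subsetD[OF diag_dom ket_proj_mem], rule subsetD[OF diag_cod ket_proj_mem])

lemma \<theta>_mem: "T \<in> \<U> \<Longrightarrow> \<theta> T \<in> \<V>"
  by (rule complete_isometry_mem[OF fwd.ci])

lemma \<theta>_linear: "T \<in> \<U> \<Longrightarrow> blinfun_apply (\<theta> T) (c *\<^sub>C f) = c *\<^sub>C blinfun_apply (\<theta> T) f"
  by (rule operator_space_linear[OF bwd.os \<theta>_mem])

lemma \<theta>_range: "T \<in> \<U> \<Longrightarrow> blinfun_apply (\<theta> T) f \<in> ell2_on \<Delta>"
  by (rule operator_space_range[OF bwd.os \<theta>_mem])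

text \<open>
  With \<open>q = \<theta> p\<^sub>x\<close>, contractivity of \<open>\<theta>\<close> on \<open>p\<^sub>x + z (1 - p\<^sub>x)\<close> says that \<open>\<parallel>q \<eta> + z (\<eta> - q \<eta>)\<parallel>\<close> is at most
  \<open>\<parallel>\<eta>\<parallel>\<close>, its value at \<open>z = 1\<close>. So among all \<open>z\<close> of modulus one, \<open>Re (cnj z * D)\<close> is largest at
  \<open>z = 1\<close>, which means that \<open>D\<close> is real and nonnegative.
\<close>

lemma defect_form_nonneg:
  assumes x: "x \<in> \<Gamma>" and \<eta>: "\<eta> \<in> ell2_on \<Delta>"
  defines "D \<equiv> cinner (blinfun_apply (\<theta> (ket_proj \<Gamma> x)) \<eta>) (\<eta> - blinfun_apply (\<theta> (ket_proj \<Gamma> x)) \<eta>)"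
  shows "Im D = 0 \<and> 0 \<le> Re D"
proof -
  define q where "q = \<theta> (ket_proj \<Gamma> x)"
  have D: "D = cinner (blinfun_apply q \<eta>) (\<eta> - blinfun_apply q \<eta>)"
    by (simp add: D_def q_def)
  have rot: "Re (cnj z * D) \<le> Re D" if z: "cmod z = 1" for z
  proof -
    let ?S = "scale_op (1 - z) (ket_proj \<Gamma> x) + scale_op z (id_op \<Gamma>)"
    have S: "?S \<in> \<U>"
      by (intro operator_space_add[OF fwd.os] operator_space_scale[OF fwd.os] ket_proj_mem_dom fwd.id_mem)
    have "\<theta> ?S = scale_op (1 - z) q + scale_op z (id_op \<Delta>)"
      by (simp add: q_def complete_isometry_add[OF fwd.ci] complete_isometry_scale[OF fwd.ci]
          operator_space_scale[OF fwd.os] ket_proj_mem_dom fwd.id_mem fwd.unital)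
    then have "blinfun_apply (\<theta> ?S) \<eta> = blinfun_apply q \<eta> + z *\<^sub>C (\<eta> - blinfun_apply q \<eta>)"
      using \<eta> by (simp add: blinfun.add_left id_op_apply scaleC_diff_right)
        (simp add: scaleC_add_left[of 1 "- z", simplified] scaleC_minus_left)
    moreover have "norm (blinfun_apply (\<theta> ?S) \<eta>) \<le> 1 * norm \<eta>"
      by (rule complete_isometry_contraction[OF fwd.ci S norm_ket_rotation_le[OF x z]])
    ultimately have "(norm (blinfun_apply q \<eta> + z *\<^sub>C (\<eta> - blinfun_apply q \<eta>)))\<^sup>2
        \<le> (norm (blinfun_apply q \<eta> + (\<eta> - blinfun_apply q \<eta>)))\<^sup>2"
      by (simp add: power_mono)
    then show ?thesis
      unfolding norm_sq_add[of "blinfun_apply q \<eta>"] cinner_scaleC_right D[symmetric]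
      by (simp add: norm_scaleC z)
  qed
  have "cmod D \<le> Re D"
  proof (cases "D = 0")
    case False
    have "cnj (D / complex_of_real (cmod D)) * D = complex_of_real (cmod D)"
      using False complex_norm_square[of D] by (simp add: power2_eq_square field_simps)
    then show ?thesis
      using rot[of "D / complex_of_real (cmod D)"] False by (simp add: norm_divide)
  qed simp
  then have "(cmod D)\<^sup>2 \<le> (Re D)\<^sup>2" "0 \<le> Re D"
    using norm_ge_zero[of D] by (auto intro: power_mono order_trans simp del: norm_ge_zero)
  then show ?thesis
    by (simp add: cmod_power2)
qed

text \<open>
  Let \<open>q = \<theta> p\<^sub>x\<close>, and let \<open>\<xi>\<close> be a unit vector almost fixed by \<open>\<psi> p\<^sub>y\<close>. Since \<open>\<psi> q = p\<^sub>x\<close>, the peaking bounds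
  for \<open>\<psi>\<close> give \<open>\<parallel>p\<^sub>x \<xi>\<parallel>\<^sup>2 \<le> \<parallel>q (ket y)\<parallel>\<^sup>2\<close> and \<open>Re \<langle>q (ket y), ket y\<rangle> \<le> Re \<langle>p\<^sub>x \<xi>, \<xi>\<rangle>\<close> up to small errors, and
  \<open>\<langle>p\<^sub>x \<xi>, \<xi>\<rangle> = \<parallel>p\<^sub>x \<xi>\<parallel>\<^sup>2\<close> because \<open>p\<^sub>x\<close> is a projection. Together these reverse the inequality that the
  nonnegativity of the defect form expresses at \<open>ket y\<close>.
\<close>

lemma defect_form_ket:
  assumes x: "x \<in> \<Gamma>" and y: "y \<in> \<Delta>"
  shows "cinner (blinfun_apply (\<theta> (ket_proj \<Gamma> x)) (ket y)) (ket y - blinfun_apply (\<theta> (ket_proj \<Gamma> x)) (ket y)) = 0"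
proof -
  let ?p = "ket_proj \<Delta> y" and ?q = "\<theta> (ket_proj \<Gamma> x)"
  note p = ket_proj_mem_cod ket_proj_apply[OF y] norm_ket
  have q: "?q \<in> \<V>" "scale_op (- 1) ?q \<in> \<V>"
    by (auto intro!: \<theta>_mem ket_proj_mem_dom operator_space_scale[OF bwd.os])
  have \<psi>q: "\<psi> ?q = ket_proj \<Gamma> x" "\<psi> (scale_op (- 1) ?q) = scale_op (- 1) (ket_proj \<Gamma> x)"
    by (simp_all add: complete_isometry_scale[OF bwd.ci q(1)] inv_left ket_proj_mem_dom)
  have le: "Re (cinner (blinfun_apply ?q (ket y)) (ket y)) \<le> (norm (blinfun_apply ?q (ket y)))\<^sup>2"
  proof (rule field_le_epsilon)
    fix \<delta> :: real assume "0 < \<delta>"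
    then have \<delta>: "0 < \<delta> / 2" by simp
    obtain \<epsilon>1 where \<epsilon>1: "0 < \<epsilon>1" "\<And>w. \<lbrakk>norm w = 1; 1 - \<epsilon>1 \<le> (norm (blinfun_apply (\<psi> ?p) w))\<^sup>2\<rbrakk>
     \<Longrightarrow> (norm (blinfun_apply (\<psi> ?q) w))\<^sup>2 \<le> (norm (blinfun_apply ?q (ket y)))\<^sup>2 + \<delta> / 2"
      by (rule bwd.peak_norm_le[OF p q(1) \<delta>]) (rule that)
    obtain \<epsilon>2 where \<epsilon>2: "0 < \<epsilon>2" "\<And>w. \<lbrakk>norm w = 1; w \<in> ell2_on \<Gamma>; 1 - \<epsilon>2 \<le> (norm (blinfun_apply (\<psi> ?p) w))\<^sup>2\<rbrakk>
     \<Longrightarrow> Re (cinner (blinfun_apply (\<psi> (scale_op (- 1) ?q)) w) w)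
       \<le> Re (cinner (blinfun_apply (scale_op (- 1) ?q) (ket y)) (ket y)) + \<delta> / 2"
      by (rule bwd.peak_form_le[OF p ket_in_ell2_on[OF y] q(2) \<delta>]) (rule that)
    obtain \<xi> where \<xi>: "\<xi> \<in> ell2_on \<Gamma>" "norm \<xi> = 1" "1 - min \<epsilon>1 \<epsilon>2 \<le> (norm (blinfun_apply (\<psi> ?p) \<xi>))\<^sup>2"
    proof (rule fwd.norming_vector[where w = "ket y"])
      show "\<psi> ?p \<in> \<U>"
        by (rule complete_isometry_mem[OF bwd.ci ket_proj_mem_cod])
      show "norm (blinfun_apply (\<theta> (\<psi> ?p)) (ket y)) = 1"
        by (simp add: inv_right ket_proj_mem_cod ket_proj_apply[OF y] cinner_ket ket.rep_eq)
      show "0 < min \<epsilon>1 \<epsilon>2" using \<epsilon>1(1) \<epsilon>2(1) by simp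
    qed auto
    have px: "Re (cinner (blinfun_apply (ket_proj \<Gamma> x) \<xi>) \<xi>) = (norm (blinfun_apply (ket_proj \<Gamma> x) \<xi>))\<^sup>2"
      by (simp add: ket_proj_apply[OF x] norm_scaleC cinner_scaleC_left cinner_ket cinner_ket_left)
        (simp add: cmod_power2 flip: power2_eq_square)
    have "- Re (cinner (blinfun_apply (ket_proj \<Gamma> x) \<xi>) \<xi>) \<le> - Re (cinner (blinfun_apply ?q (ket y)) (ket y)) + \<delta> / 2"
      using \<epsilon>2(2)[of \<xi>] \<xi> by (simp add: \<psi>q cinner_scaleC_left)
    moreover have "(norm (blinfun_apply (ket_proj \<Gamma> x) \<xi>))\<^sup>2 \<le> (norm (blinfun_apply ?q (ket y)))\<^sup>2 + \<delta> / 2"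
      using \<epsilon>1(2)[of \<xi>] \<xi> by (simp add: \<psi>q)
    ultimately show "Re (cinner (blinfun_apply ?q (ket y)) (ket y)) \<le> (norm (blinfun_apply ?q (ket y)))\<^sup>2 + \<delta>"
      using px by linarith
  qed
  have "Re (cinner (blinfun_apply ?q (ket y)) (ket y - blinfun_apply ?q (ket y))) \<le> 0"
    using le by (simp add: cinner_diff_right cinner_self_norm)
  then show ?thesis
    using defect_form_nonneg[OF x ket_in_ell2_on[OF y]] by (simp add: complex_eq_iff)
qed

text \<open>
  The defect form is nonnegative and vanishes at each \<open>ket y\<close>, so it vanishes identically. In terms
  of operators this is \<open>q = q\<^sup>* q\<close>, which makes \<open>q\<close> selfadjoint and idempotent.
\<close>

lemma image_projection:
  assumes x: "x \<in> \<Gamma>" and f: "f \<in> ell2_on \<Delta>" and g: "g \<in> ell2_on \<Delta>"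
  defines "q \<equiv> \<theta> (ket_proj \<Gamma> x)"
  shows "cinner (blinfun_apply q f) g = cinner (blinfun_apply q f) (blinfun_apply q g)"
proof -
  define D where "D = (\<lambda>f g. cinner (blinfun_apply q f) (g - blinfun_apply q g))"
  have lin: "blinfun_apply q (c *\<^sub>C f) = c *\<^sub>C blinfun_apply q f" for c f
    unfolding q_def by (rule \<theta>_linear[OF ket_proj_mem_dom])
  have "D f g = 0"
  proof (rule nonneg_form_eq_0[where \<Gamma> = \<Delta>])
    show "bounded_linear (D f)" for f
      unfolding D_def
      by (intro bounded_linear_compose[OF bounded_linear_cinner_right] bounded_linear_sub
          bounded_linear_ident blinfun.bounded_linear_right)
    show "Im (D f f) = 0 \<and> 0 \<le> Re (D f f)" if "f \<in> ell2_on \<Delta>" for f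
      unfolding D_def q_def by (rule defect_form_nonneg[OF x that])
    show "D (ket y) (ket y) = 0" if "y \<in> \<Delta>" for y
      unfolding D_def q_def by (rule defect_form_ket[OF x that])
  qed (use f g in \<open>simp_all add: D_def blinfun.add_right cinner_add_left cinner_add_right cinner_diff_right lin
      cinner_scaleC_left cinner_scaleC_right algebra_simps\<close>)
  then show ?thesis
    by (simp add: D_def cinner_diff_right)
qed

lemma image_selfadjoint:
  assumes x: "x \<in> \<Gamma>" and f: "f \<in> ell2_on \<Delta>" and g: "g \<in> ell2_on \<Delta>"
  shows "cinner (blinfun_apply (\<theta> (ket_proj \<Gamma> x)) f) g = cinner f (blinfun_apply (\<theta> (ket_proj \<Gamma> x)) g)"
  by (metis image_projection[OF x f g] image_projection[OF x g f] cinner_commute)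

lemma image_idempotent:
  assumes x: "x \<in> \<Gamma>"
  defines "q \<equiv> \<theta> (ket_proj \<Gamma> x)"
  shows "blinfun_apply q (blinfun_apply q f) = blinfun_apply q f"
proof -
  have r: "blinfun_apply q f \<in> ell2_on \<Delta>" for f
    unfolding q_def by (rule \<theta>_range[OF ket_proj_mem_dom])
  let ?f = "blinfun_apply (id_op \<Delta>) f"
  let ?r = "blinfun_apply q ?f - blinfun_apply q (blinfun_apply q ?f)"
  have "?r = blinfun_apply q (?f - blinfun_apply q ?f)"
    by (simp add: blinfun.diff_right)
  moreover have "cinner (blinfun_apply q (?f - blinfun_apply q ?f)) ?r = 0"
    using image_projection[OF x ell2_on_diff[OF id_op_in_ell2_on r] r, of f ?f ?f]
    by (simp add: q_def cinner_diff_right)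
  ultimately have "cinner ?r ?r = 0" by simp
  then have "?r = 0" by (simp add: cinner_self_norm)
  then show ?thesis
    using operator_space_id_op[OF bwd.os \<theta>_mem[OF ket_proj_mem_dom]] by (simp add: q_def)
qed

lemma image_fixes_unit_vector:
  assumes x: "x \<in> \<Gamma>"
  obtains w where "norm w = 1" "w \<in> ell2_on \<Delta>" "blinfun_apply (\<theta> (ket_proj \<Gamma> x)) w = w"
proof -
  let ?q = "\<theta> (ket_proj \<Gamma> x)"
  have "\<exists>f. blinfun_apply ?q f \<noteq> 0"
  proof (rule ccontr)
    assume "\<nexists>f. blinfun_apply ?q f \<noteq> 0"
    then have "norm (blinfun_apply (\<psi> ?q) (ket x)) \<le> 0 * norm (ket x)"
      by (intro complete_isometry_contraction[OF bwd.ci \<theta>_mem[OF ket_proj_mem_dom]]) auto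
    then show False
      by (simp add: inv_left ket_proj_mem_dom ket_proj_apply[OF x] cinner_ket ket.rep_eq)
  qed
  then obtain f where f: "blinfun_apply ?q f \<noteq> 0" by blast
  let ?w = "complex_of_real (1 / norm (blinfun_apply ?q f)) *\<^sub>C blinfun_apply ?q f"
  show thesis
  proof (rule that[of ?w])
    show "norm ?w = 1"
      using f by (simp add: norm_scaleC norm_divide)
    show "?w \<in> ell2_on \<Delta>"
      by (intro ell2_on_scaleC \<theta>_range ket_proj_mem_dom)
    show "blinfun_apply ?q ?w = ?w"
      by (simp only: \<theta>_linear[OF ket_proj_mem_dom] image_idempotent[OF x])
  qed
qed

text \<open>
  This is the peaking argument at \<open>p\<^sub>x\<close> applied to the operator \<open>\<psi> p\<^sub>y\<close>, whose image under \<open>\<theta>\<close> is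
  \<open>p\<^sub>y\<close>. The right-hand side does not involve \<open>w\<close>: all unit vectors in the range of \<open>\<theta> p\<^sub>x\<close> have
  coordinates of the same moduli.
\<close>

lemma fixed_vector_coordinates:
  assumes x: "x \<in> \<Gamma>" and y: "y \<in> \<Delta>"
    and w: "norm w = 1" "w \<in> ell2_on \<Delta>" "blinfun_apply (\<theta> (ket_proj \<Gamma> x)) w = w"
  shows "complex_of_real ((cmod (ell2_fun w y))\<^sup>2) = cinner (blinfun_apply (\<psi> (ket_proj \<Delta> y)) (ket x)) (ket x)"
proof -
  have "cinner (blinfun_apply (\<theta> (\<psi> (ket_proj \<Delta> y))) w) w = cinner (blinfun_apply (\<psi> (ket_proj \<Delta> y)) (ket x)) (ket x)"
    by (rule fwd.peak_form_eq[OF ket_proj_mem_dom ket_proj_apply[OF x] norm_ket ket_in_ell2_on[OF x] w])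
      (rule complete_isometry_mem[OF bwd.ci ket_proj_mem_cod])
  then show ?thesis
    by (simp add: inv_right ket_proj_mem_cod ket_proj_apply[OF y] cinner_scaleC_left cinner_ket cinner_ket_left
        complex_norm_square del: of_real_power)
qed

text \<open>
  If \<open>w\<close> has a nonzero coordinate at \<open>y\<close>, then so has every nonzero vector in the range, since
  the modulus of that coordinate is the same for all unit vectors of the range. Subtracting a
  multiple of \<open>w\<close> that kills this coordinate therefore leaves zero.
\<close>

lemma image_rank_one:
  assumes x: "x \<in> \<Gamma>"
    and w: "norm w = 1" "w \<in> ell2_on \<Delta>" "blinfun_apply (\<theta> (ket_proj \<Gamma> x)) w = w"
  shows "blinfun_apply (\<theta> (ket_proj \<Gamma> x)) \<eta> = cinner \<eta> w *\<^sub>C w"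
proof -
  let ?q = "\<theta> (ket_proj \<Gamma> x)"
  obtain y where y: "y \<in> \<Delta>" "ell2_fun w y \<noteq> 0"
  proof -
    have "w \<noteq> 0" using w(1) by auto
    then obtain y where "ell2_fun w y \<noteq> 0"
      using ell2_eqI[of w 0] by (auto simp: zero_ell2.rep_eq)
    then show thesis using w(2) that by (auto simp: ell2_on_def)
  qed
  define c where "c = ell2_fun (blinfun_apply ?q \<eta>) y / ell2_fun w y"
  define \<zeta> where "\<zeta> = blinfun_apply ?q \<eta> - c *\<^sub>C w"
  have \<zeta>: "\<zeta> \<in> ell2_on \<Delta>" "blinfun_apply ?q \<zeta> = \<zeta>" "ell2_fun \<zeta> y = 0"
    using y by (simp_all add: \<zeta>_def c_def ell2_on_diff ell2_on_scaleC \<theta>_range ket_proj_mem_dom w blinfun.diff_right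
        image_idempotent[OF x] \<theta>_linear ell2_fun_diff scaleC.rep_eq)
  have "\<zeta> = 0"
  proof (rule ccontr)
    assume nz: "\<zeta> \<noteq> 0"
    let ?u = "complex_of_real (1 / norm \<zeta>) *\<^sub>C \<zeta>"
    have "norm ?u = 1" "?u \<in> ell2_on \<Delta>" "blinfun_apply ?q ?u = ?u"
      using nz \<zeta> by (simp_all only: norm_scaleC \<theta>_linear ket_proj_mem_dom ell2_on_scaleC) (simp add: norm_divide)
    from fixed_vector_coordinates[OF x y(1) this] fixed_vector_coordinates[OF x y(1) w]
    have "(cmod (ell2_fun w y))\<^sup>2 = (cmod (ell2_fun ?u y))\<^sup>2"
      by (metis of_real_eq_iff)
    then show False
      using y(2) \<zeta>(3) by (simp add: scaleC.rep_eq)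
  qed
  then have *: "blinfun_apply ?q \<eta> = c *\<^sub>C w"
    by (simp add: \<zeta>_def)
  let ?\<eta> = "blinfun_apply (id_op \<Delta>) \<eta>"
  have "c = cinner (blinfun_apply ?q \<eta>) w"
    by (simp add: * cinner_scaleC_left cinner_self_norm w(1))
  also have "\<dots> = cinner (blinfun_apply ?q ?\<eta>) w"
    by (simp add: operator_space_id_op[OF bwd.os \<theta>_mem[OF ket_proj_mem_dom]])
  also have "\<dots> = cinner ?\<eta> w"
    using image_selfadjoint[OF x id_op_in_ell2_on w(2)] w(3) by simp
  finally show ?thesis
    using * cinner_id_op[OF w(2)] by simp
qed

text \<open>
  This vector is determined by \<open>x\<close> only up to a phase, which the choice leaves arbitrary; the
  phases are corrected later.
\<close>

definition peak :: "'a \<Rightarrow> 'b ell2" where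
  "peak x = (SOME w. norm w = 1 \<and> w \<in> ell2_on \<Delta> \<and> blinfun_apply (\<theta> (ket_proj \<Gamma> x)) w = w)"

lemma peak:
  assumes "x \<in> \<Gamma>"
  shows "norm (peak x) = 1" "peak x \<in> ell2_on \<Delta>" "blinfun_apply (\<theta> (ket_proj \<Gamma> x)) (peak x) = peak x"
  unfolding atomize_conj peak_def
  by (rule someI_ex) (use image_fixes_unit_vector[OF assms] in blast)

lemma image_apply: "x \<in> \<Gamma> \<Longrightarrow> blinfun_apply (\<theta> (ket_proj \<Gamma> x)) \<eta> = cinner \<eta> (peak x) *\<^sub>C peak x"
  by (intro image_rank_one peak)

lemma peak_orthonormal:
  assumes "x \<in> \<Gamma>" "z \<in> \<Gamma>"
  shows "cinner (peak x) (peak z) = (if x = z then 1 else 0)"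
proof (cases "x = z")
  case False
  have "cinner (blinfun_apply (\<theta> (ket_proj \<Gamma> z)) (peak x)) (peak x) = cinner (blinfun_apply (ket_proj \<Gamma> z) (ket x)) (ket x)"
    by (rule fwd.peak_form_eq[OF ket_proj_mem_dom ket_proj_apply norm_ket ket_in_ell2_on peak ket_proj_mem_dom])
      (use assms in auto)
  also have "\<dots> = 0"
    using assms False by (simp add: ket_proj_apply cinner_scaleC_left cinner_ket ket.rep_eq zero_ell2.rep_eq)
  finally have "cinner (peak x) (peak z) * cinner (peak z) (peak x) = 0"
    by (simp add: image_apply[OF assms(2)] cinner_scaleC_left)
  then show ?thesis
    using False cinner_commute[of "peak z" "peak x"] by auto
qed (simp add: cinner_self_norm peak assms)

text \<open>
  The numbers \<open>|\<langle>ket y, peak x\<rangle>|\<^sup>2 = \<langle>\<theta> p\<^sub>x (ket y), ket y\<rangle>\<close> are the squared moduli of the coordinates of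
  a unit vector fixed by \<open>\<psi> p\<^sub>y\<close>, so they sum to one. This is Parseval's identity at \<open>ket y\<close>.
\<close>

lemma peak_complete:
  assumes y: "y \<in> \<Delta>"
  shows "((\<lambda>x. (cmod (ell2_fun (peak x) y))\<^sup>2) has_sum 1) \<Gamma>"
proof -
  interpret swap: masa_isomorphism \<Delta> \<Gamma> \<V> \<U> \<psi> \<theta> by (rule swap)
  let ?v = "swap.peak y"
  have v: "norm ?v = 1" "?v \<in> ell2_on \<Gamma>" "blinfun_apply (\<psi> (ket_proj \<Delta> y)) ?v = ?v"
    by (rule swap.peak[OF y])+
  have "(cmod (ell2_fun ?v x))\<^sup>2 = (cmod (ell2_fun (peak x) y))\<^sup>2" if x: "x \<in> \<Gamma>" for x
  proof -
    have "complex_of_real ((cmod (ell2_fun ?v x))\<^sup>2) = cinner (blinfun_apply (\<theta> (ket_proj \<Gamma> x)) (ket y)) (ket y)"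
      by (rule swap.fixed_vector_coordinates[OF y x v])
    also have "\<dots> = complex_of_real ((cmod (ell2_fun (peak x) y))\<^sup>2)"
      by (simp add: image_apply[OF x] cinner_ket cinner_ket_left scaleC.rep_eq complex_norm_square mult.commute
          del: of_real_power)
    finally show ?thesis by (metis of_real_eq_iff)
  qed
  then have "((\<lambda>x. (cmod (ell2_fun ?v x))\<^sup>2) has_sum 1) \<Gamma> \<longleftrightarrow> ((\<lambda>x. (cmod (ell2_fun (peak x) y))\<^sup>2) has_sum 1) \<Gamma>"
    by (rule has_sum_cong)
  moreover have "((\<lambda>x. (cmod (ell2_fun ?v x))\<^sup>2) has_sum 1) UNIV"
    using has_sum_infsum[OF ell2_summable[of ?v]] v(1) by (simp add: norm_sq_infsum[symmetric])
  then have "((\<lambda>x. (cmod (ell2_fun ?v x))\<^sup>2) has_sum 1) \<Gamma>"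
    by (rule has_sum_cong_neutral[THEN iffD1, rotated -1]) (use v(2) in \<open>auto simp: ell2_on_def\<close>)
  ultimately show ?thesis by simp
qed

end


section \<open>Matrix entries and phases around cycles\<close>

text \<open>
  Summing the contributions of all \<open>s\<close> in each matrix position, instead of storing one operator
  per position, is what allows several prescribed entries to fall into the same position. This
  happens in cycles of length two.
\<close>

lemma sum_matrix_of_entries:
  fixes r c :: "nat \<Rightarrow> nat"
  assumes "\<forall>s<m. r s < n \<and> c s < n"
  shows "(\<Sum>i<n. cnj (a i) * cinner (\<Sum>j<n. a j *\<^sub>C blinfun_apply (\<Sum>s<m. if r s = i \<and> c s = j then R s else 0) (u j)) (u i))
    = (\<Sum>s<m. cnj (a (r s)) * a (c s) * cinner (blinfun_apply (R s) (u (c s))) (u (r s)))"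
    (is "?L = ?R")
proof -
  define g where "g = (\<lambda>s. cnj (a (r s)) * a (c s) * cinner (blinfun_apply (R s) (u (c s))) (u (r s)))"
  have "cnj (a i) * cinner (\<Sum>j<n. a j *\<^sub>C blinfun_apply (\<Sum>s<m. if r s = i \<and> c s = j then R s else 0) (u j)) (u i)
      = (\<Sum>j<n. \<Sum>s<m. if r s = i \<and> c s = j then g s else 0)" for i
    unfolding blinfun.sum_left scaleC_sum_right cinner_sum_left sum_distrib_left
    by (intro sum.cong refl) (auto simp: g_def cinner_scaleC_left blinfun.zero_left)
  then have "?L = (\<Sum>i<n. \<Sum>j<n. \<Sum>s<m. if r s = i \<and> c s = j then g s else 0)"
    by simp
  also have "\<dots> = (\<Sum>i<n. \<Sum>s<m. \<Sum>j<n. if r s = i \<and> c s = j then g s else 0)"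
    by (intro sum.cong refl sum.swap)
  also have "\<dots> = (\<Sum>s<m. \<Sum>i<n. \<Sum>j<n. if r s = i \<and> c s = j then g s else 0)"
    by (rule sum.swap)
  also have "\<dots> = (\<Sum>s<m. g s)"
  proof (rule sum.cong)
    fix s assume "s \<in> {..<m}"
    then have s: "r s < n" "c s < n" using assms by auto
    have "(\<Sum>j<n. if r s = i \<and> c s = j then g s else 0) = (if i = r s then g s else 0)" for i
      using s by (cases "i = r s") (auto simp: sum.delta')
    then show "(\<Sum>i<n. \<Sum>j<n. if r s = i \<and> c s = j then g s else 0) = g s"
      using s by simp
  qed simp
  finally show ?thesis by (simp add: g_def)
qed

context unital_complete_isometry
begin

lemma entries_compression_le:
  fixes P :: "nat \<Rightarrow> ('a ell2 \<Rightarrow>\<^sub>L 'a ell2)" and r c :: "nat \<Rightarrow> nat"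
  assumes P: "\<And>j. j < n \<Longrightarrow> P j \<in> \<U>"
    and Papp: "\<And>j \<xi>. j < n \<Longrightarrow> blinfun_apply (P j) \<xi> = cinner \<xi> (v j) *\<^sub>C v j"
    and v: "\<And>j. j < n \<Longrightarrow> norm (v j) = 1" "\<And>j. j < n \<Longrightarrow> v j \<in> ell2_on \<Gamma>"
    and w: "\<And>j. j < n \<Longrightarrow> norm (w j) = 1" "\<And>j. j < n \<Longrightarrow> w j \<in> ell2_on \<Delta>"
      "\<And>j. j < n \<Longrightarrow> blinfun_apply (\<theta> (P j)) (w j) = w j"
    and T: "\<And>s. s < m \<Longrightarrow> T s \<in> \<U>" and rc: "\<forall>s<m. r s < n \<and> c s < n"
    and K: "\<And>a. Re (\<Sum>s<m. cnj (a (r s)) * a (c s) * cinner (blinfun_apply (T s) (v (c s))) (v (r s)))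
        \<le> K * (\<Sum>j<n. (cmod (a j))\<^sup>2)"
    and a: "(\<Sum>j<n. (cmod (a j))\<^sup>2) = 1"
  shows "Re (\<Sum>s<m. cnj (a (r s)) * a (c s) * cinner (blinfun_apply (\<theta> (T s)) (w (c s))) (w (r s))) \<le> K"
proof -
  define M where "M = (\<lambda>i j. \<Sum>s<m. if r s = i \<and> c s = j then T s else 0)"
  have M: "M i j \<in> \<U>" for i j
    unfolding M_def by (rule operator_space_sum[OF os]) (auto simp: T operator_space_zero[OF os])
  have "\<theta> (M i j) = (\<Sum>s<m. \<theta> (if r s = i \<and> c s = j then T s else 0))" for i j
    unfolding M_def by (rule complete_isometry_sum[OF ci os]) (auto simp: T operator_space_zero[OF os])
  then have \<theta>M: "\<theta> (M i j) = (\<Sum>s<m. if r s = i \<and> c s = j then \<theta> (T s) else 0)" for i j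
    using complete_isometry_zero[OF ci operator_space_zero[OF os]] by (simp add: if_distrib cong: if_cong)
  have "Re (\<Sum>i<n. cnj (a i) * cinner (\<Sum>j<n. a j *\<^sub>C blinfun_apply (\<theta> (M i j)) (w j)) (w i)) \<le> K"
  proof (rule form_compression_le[OF P Papp v M _ w a])
    show "Re (\<Sum>i<n. cnj (a i) * cinner (\<Sum>j<n. a j *\<^sub>C blinfun_apply (M i j) (v j)) (v i))
        \<le> K * (\<Sum>j<n. (cmod (a j))\<^sup>2)" for a
      unfolding M_def sum_matrix_of_entries[OF rc] by (rule K)
  qed auto
  then show ?thesis
    unfolding \<theta>M sum_matrix_of_entries[OF rc] .
qed

text \<open>
  A two by two matrix whose single nonzero entry is \<open>t\<close> has numerical radius \<open>|t| / 2\<close>.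
\<close>

lemma entry_norm_le:
  assumes P: "P0 \<in> \<U>" "P1 \<in> \<U>" "\<And>\<xi>. blinfun_apply P0 \<xi> = cinner \<xi> v0 *\<^sub>C v0" "\<And>\<xi>. blinfun_apply P1 \<xi> = cinner \<xi> v1 *\<^sub>C v1"
    and v: "norm v0 = 1" "norm v1 = 1" "v0 \<in> ell2_on \<Gamma>" "v1 \<in> ell2_on \<Gamma>"
    and w: "norm w0 = 1" "norm w1 = 1" "w0 \<in> ell2_on \<Delta>" "w1 \<in> ell2_on \<Delta>"
      "blinfun_apply (\<theta> P0) w0 = w0" "blinfun_apply (\<theta> P1) w1 = w1"
    and T: "T \<in> \<U>"
  shows "cmod (cinner (blinfun_apply (\<theta> T) w0) w1) \<le> cmod (cinner (blinfun_apply T v0) v1)"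
proof (cases "cinner (blinfun_apply (\<theta> T) w0) w1 = 0")
  case False
  let ?t = "cinner (blinfun_apply T v0) v1" and ?t' = "cinner (blinfun_apply (\<theta> T) w0) w1"
  define a where "a = (\<lambda>j::nat. complex_of_real (1 / sqrt 2) * (if j = 0 then 1 else ?t' / complex_of_real (cmod ?t')))"
  have "Re (\<Sum>s<1::nat. cnj (a 1) * a 0 * cinner (blinfun_apply (\<theta> T) (if 0 = (0::nat) then w0 else w1)) (if 1 = (0::nat) then w0 else w1))
      \<le> cmod ?t / 2"
  proof (rule entries_compression_le[where n = 2 and m = 1 and P = "\<lambda>j. if j = 0 then P0 else P1"
        and v = "\<lambda>j. if j = 0 then v0 else v1" and w = "\<lambda>j. if j = 0 then w0 else w1" and T = "\<lambda>_. T"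
        and r = "\<lambda>_. 1" and c = "\<lambda>_. 0" and a = a])
    fix b :: "nat \<Rightarrow> complex"
    have "Re (cnj (b 1) * b 0 * ?t) \<le> cmod (cnj (b 1) * b 0 * ?t)"
      by (rule complex_Re_le_cmod)
    also have "\<dots> = (cmod (b 0) * cmod (b 1)) * cmod ?t"
      by (simp add: norm_mult)
    also have "\<dots> \<le> (((cmod (b 0))\<^sup>2 + (cmod (b 1))\<^sup>2) / 2) * cmod ?t"
      using sum_squares_bound[of "cmod (b 0)" "cmod (b 1)"] by (intro mult_right_mono) auto
    finally show "Re (\<Sum>s<1::nat. cnj (b 1) * b 0 * cinner (blinfun_apply T (if 0 = (0::nat) then v0 else v1)) (if 1 = (0::nat) then v0 else v1))
        \<le> cmod ?t / 2 * (\<Sum>j<2. (cmod (b j))\<^sup>2)"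
      by (simp add: numeral_2_eq_2 algebra_simps)
    show "(\<Sum>j<2. (cmod (a j))\<^sup>2) = 1"
      using False by (simp add: a_def numeral_2_eq_2 norm_mult norm_divide power_divide)
  qed (use assms in auto)
  also have "(\<Sum>s<1::nat. cnj (a 1) * a 0 * cinner (blinfun_apply (\<theta> T) (if 0 = (0::nat) then w0 else w1)) (if 1 = (0::nat) then w0 else w1))
      = cnj (a 1) * a 0 * ?t'"
    by simp
  also have "cnj (a 1) * a 0 * ?t' = complex_of_real (cmod ?t' / 2)"
  proof -
    have s: "complex_of_real (sqrt 2) * complex_of_real (sqrt 2) = 2"
      by (simp flip: of_real_mult)
    have "cnj ?t' * ?t' = complex_of_real (cmod ?t') * complex_of_real (cmod ?t')"
      using complex_norm_square[of ?t'] by (simp add: power2_eq_square mult.commute)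
    then show ?thesis
      using False s by (simp add: a_def field_simps)
  qed
  finally show ?thesis by simp
qed simp

end

lemma sum_cyclic_shift: "(\<Sum>i<n. f (Suc i mod n)) = (\<Sum>i<n. f i)" for n :: nat
proof (cases n)
  case (Suc m)
  have "(\<Sum>i<m. f (Suc i mod Suc m)) = (\<Sum>i<m. f (Suc i))"
    by (rule sum.cong) auto
  then show ?thesis
    using sum.lessThan_Suc_shift[of f m] by (simp add: Suc add.commute)
qed simp

text \<open>
  After the substitution \<open>b i = cnj (u i) * a i\<close> the form becomes \<open>\<Sum>i. Re (b i * cnj (b (i + 1)))\<close>,
  which differs from \<open>\<Sum>i. |b i|\<^sup>2\<close> by half the sum of the \<open>|b i - b (i + 1)|\<^sup>2\<close>. After one turn,
  however, \<open>b 0\<close> has been replaced by \<open>\<omega> b 0\<close> with \<open>\<omega> = cnj (u n) * u 0\<close>; so the differences must add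
  up to at least \<open>|1 - \<omega>| |b k|\<close> for every \<open>k\<close>, and the Cauchy-Schwarz inequality bounds the sum of
  their squares from below.
\<close>

lemma cyclic_phase_gap:
  fixes u a :: "nat \<Rightarrow> complex"
  assumes n: "0 < n" and u: "\<And>i. i \<le> n \<Longrightarrow> cmod (u i) = 1"
  shows "(\<Sum>i<n. Re ((cnj (u i) * a i) * cnj (cnj (u (Suc i)) * a (Suc i mod n))))
    \<le> (1 - (cmod (u n - u 0))\<^sup>2 / (2 * (real n)\<^sup>2)) * (\<Sum>i<n. (cmod (a i))\<^sup>2)"
proof -
  define b where "b = (\<lambda>i. cnj (u i) * a (i mod n))"
  define d where "d = (\<lambda>i. b i - b (Suc i))"
  let ?R = "\<Sum>i<n. Re ((cnj (u i) * a i) * cnj (cnj (u (Suc i)) * a (Suc i mod n)))"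
  let ?S = "\<Sum>i<n. (cmod (a i))\<^sup>2" and ?\<omega> = "cmod (u n - u 0)"
  have d2: "(\<Sum>i<n. (cmod (d i))\<^sup>2) = 2 * ?S - 2 * ?R"
  proof -
    have "(cmod (d i))\<^sup>2 = (cmod (a i))\<^sup>2 + (cmod (a (Suc i mod n)))\<^sup>2
        - 2 * Re ((cnj (u i) * a i) * cnj (cnj (u (Suc i)) * a (Suc i mod n)))" if "i < n" for i
    proof -
      have e: "(cmod (p - q))\<^sup>2 = (cmod p)\<^sup>2 + (cmod q)\<^sup>2 - 2 * Re (p * cnj q)" for p q
        by (simp add: cmod_power2) (simp add: power2_eq_square algebra_simps)
      have "cmod (b i) = cmod (a i)" "cmod (b (Suc i)) = cmod (a (Suc i mod n))"
        using that by (auto simp: b_def norm_mult u)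
      then show ?thesis
        unfolding d_def e using that by (simp only:) (simp only: b_def mod_less)
    qed
    then have "(\<Sum>i<n. (cmod (d i))\<^sup>2) = ?S + (\<Sum>i<n. (cmod (a (Suc i mod n)))\<^sup>2) - 2 * ?R"
      by (simp add: sum.distrib sum_subtractf sum_distrib_left)
    then show ?thesis
      using sum_cyclic_shift[of "\<lambda>i. (cmod (a i))\<^sup>2" n] by simp
  qed
  have tele: "cmod (b k - b l) \<le> (\<Sum>i=k..<l. cmod (d i))" if "k \<le> l" for k l
  proof -
    have "b k - b l = (\<Sum>i=k..<l. d i)"
      using sum_Suc_diff'[OF that, of b] by (simp add: d_def sum_subtractf algebra_simps)
    then show ?thesis by (simp add: norm_sum)
  qed
  have k: "?\<omega>\<^sup>2 * (cmod (a k))\<^sup>2 \<le> real n * (\<Sum>i<n. (cmod (d i))\<^sup>2)" if "k < n" for k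
  proof -
    define \<omega> where "\<omega> = cnj (u n) * u 0"
    have uu: "u i * cnj (u i) = 1" if "i \<le> n" for i
      using complex_norm_square[of "u i"] u[OF that] by simp
    have bn: "b n = \<omega> * b 0"
      using uu[of 0] by (simp add: b_def \<omega>_def mult.assoc[symmetric])
    have "u n - u 0 = u n * (1 - \<omega>)"
      using uu[of n] by (simp add: \<omega>_def right_diff_distrib mult.assoc[symmetric])
    then have \<omega>1: "?\<omega> = cmod (1 - \<omega>)"
      using u[of n] by (simp add: norm_mult)
    have "?\<omega> * cmod (a k) = cmod ((1 - \<omega>) * b k)"
      using that by (simp add: \<omega>1 norm_mult b_def u)
    also have "(1 - \<omega>) * b k = (b k - b n) + \<omega> * (b 0 - b k)"
      by (simp add: bn algebra_simps)
    also have "cmod \<dots> \<le> cmod (b k - b n) + cmod (b 0 - b k)"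
      using norm_triangle_ineq[of "b k - b n" "\<omega> * (b 0 - b k)"] u[of n] u[of 0]
      by (simp add: norm_mult \<omega>_def)
    also have "\<dots> \<le> (\<Sum>i=k..<n. cmod (d i)) + (\<Sum>i=0..<k. cmod (d i))"
      using that by (intro add_mono tele) auto
    also have "\<dots> = (\<Sum>i<n. 1 * cmod (d i))"
      using that by (simp add: lessThan_atLeast0 sum.atLeastLessThan_concat add.commute)
    finally have "(?\<omega> * cmod (a k))\<^sup>2 \<le> (\<Sum>i<n. 1 * cmod (d i))\<^sup>2"
      by (intro power_mono) auto
    also have "\<dots> \<le> (\<Sum>i<n. 1\<^sup>2) * (\<Sum>i<n. (cmod (d i))\<^sup>2)"
      by (rule Cauchy_Schwarz_ineq_sum)
    finally show ?thesis by (simp add: power_mult_distrib)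
  qed
  have "?\<omega>\<^sup>2 * ?S \<le> (\<Sum>k<n. real n * (\<Sum>i<n. (cmod (d i))\<^sup>2))"
    unfolding sum_distrib_left by (rule sum_mono) (use k in \<open>simp add: sum_distrib_left\<close>)
  also have "\<dots> = (real n)\<^sup>2 * (2 * ?S - 2 * ?R)"
    by (simp only: d2 sum_constant card_lessThan) (simp only: power2_eq_square mult.assoc)
  finally have "?\<omega>\<^sup>2 * ?S \<le> (real n)\<^sup>2 * (2 * ?S - 2 * ?R)" .
  moreover have "R \<le> (1 - w / (2 * N)) * S" if "w * S \<le> N * (2 * S - 2 * R)" "0 < N" for R S w N :: real
    using that by (simp add: field_simps)
  ultimately show ?thesis
    using n by simp
qed

context masa_isomorphism
begin

definition entry :: "('a ell2 \<Rightarrow>\<^sub>L 'a ell2) \<Rightarrow> 'a \<Rightarrow> 'a \<Rightarrow> complex" where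
  "entry T x z = cinner (blinfun_apply T (ket x)) (ket z)"

definition image_entry :: "('a ell2 \<Rightarrow>\<^sub>L 'a ell2) \<Rightarrow> 'a \<Rightarrow> 'a \<Rightarrow> complex" where
  "image_entry T x z = cinner (blinfun_apply (\<theta> T) (peak x)) (peak z)"

lemma inverse_image_fixes_ket:
  "x \<in> \<Gamma> \<Longrightarrow> blinfun_apply (\<psi> (\<theta> (ket_proj \<Gamma> x))) (ket x) = ket x"
  by (simp add: inv_left ket_proj_mem_dom ket_proj_apply cinner_ket ket.rep_eq)

lemma norm_image_entry:
  assumes x: "x \<in> \<Gamma>" and z: "z \<in> \<Gamma>" and T: "T \<in> \<U>"
  shows "cmod (image_entry T x z) = cmod (entry T x z)"
proof (rule antisym)
  show "cmod (image_entry T x z) \<le> cmod (entry T x z)"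
    unfolding image_entry_def entry_def
    by (rule fwd.entry_norm_le[OF ket_proj_mem_dom ket_proj_mem_dom ket_proj_apply[OF x] ket_proj_apply[OF z]])
      (simp_all add: x z T peak ket_in_ell2_on)
  have "cmod (cinner (blinfun_apply (\<psi> (\<theta> T)) (ket x)) (ket z)) \<le> cmod (cinner (blinfun_apply (\<theta> T) (peak x)) (peak z))"
    by (rule bwd.entry_norm_le[OF \<theta>_mem[OF ket_proj_mem_dom] \<theta>_mem[OF ket_proj_mem_dom] image_apply[OF x] image_apply[OF z]])
      (simp_all add: x z T peak ket_in_ell2_on inverse_image_fixes_ket \<theta>_mem)
  then show "cmod (entry T x z) \<le> cmod (image_entry T x z)"
    by (simp add: inv_left[OF T] image_entry_def entry_def)
qed

text \<open>
  A pair \<open>(x, u)\<close> stands for the basis vector \<open>u *\<^sub>C peak x\<close> proposed as the image of \<open>ket x\<close>. A step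
  joins two proposals that are compatible with some operator \<open>T\<close> whose entry from \<open>x\<close> to \<open>z\<close> is not
  zero.
\<close>

definition phase_step :: "'a \<times> complex \<Rightarrow> 'a \<times> complex \<Rightarrow> bool" where
  "phase_step p q \<longleftrightarrow> fst p \<in> \<Gamma> \<and> fst q \<in> \<Gamma> \<and> cmod (snd p) = 1 \<and> cmod (snd q) = 1 \<and>
     (\<exists>T\<in>\<U>. entry T (fst p) (fst q) \<noteq> 0 \<and>
       snd q * entry T (fst p) (fst q) = snd p * image_entry T (fst p) (fst q))"

lemma phase_step_normalized:
  assumes "phase_step (x, u) (z, v)"
  obtains T where "T \<in> \<U>" "entry T x z = 1" "image_entry T x z = v * cnj u"
proof -
  obtain T where T: "T \<in> \<U>" "entry T x z \<noteq> 0" "v * entry T x z = u * image_entry T x z" and u: "cmod u = 1"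
    using assms by (auto simp: phase_step_def)
  let ?T = "scale_op (1 / entry T x z) T"
  have uu: "cnj u * u = 1"
    using complex_norm_square[of u] u by (simp add: mult.commute)
  show thesis
  proof (rule that[of ?T])
    show "?T \<in> \<U>"
      by (rule operator_space_scale[OF fwd.os T(1)])
    show "entry ?T x z = 1"
      using T(2) unfolding entry_def by (simp add: cinner_scaleC_left)
    have "image_entry ?T x z = image_entry T x z / entry T x z"
      unfolding image_entry_def by (simp add: complete_isometry_scale[OF fwd.ci T(1)] cinner_scaleC_left)
    also have "image_entry T x z = (cnj u * u) * image_entry T x z"
      by (simp add: uu)
    also have "\<dots> = cnj u * (v * entry T x z)"
      by (simp add: T(3))
    finally show "image_entry ?T x z = v * cnj u"
      using T(2) by simp
  qed
qed

text \<open>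
  Transport the bound of \<open>cyclic_phase_gap\<close> for the entries of the \<open>\<theta> (T i)\<close> by \<open>\<psi>\<close>. For the
  operators \<open>T i\<close> the entries are all equal to one, and the constant unit vector gives the form the
  value one; so there is no gap. A step taken backwards contributes its entry in the transposed
  position, where the real part of the form is the same. The points of the walk may repeat, because
  each of them has its own matrix index.
\<close>

lemma phase_cycle:
  assumes n: "0 < n" and x: "\<And>i. i \<le> n \<Longrightarrow> x i \<in> \<Gamma>" and u: "\<And>i. i \<le> n \<Longrightarrow> cmod (u i) = 1"
    and step: "\<And>i. i < n \<Longrightarrow> phase_step (x i, u i) (x (Suc i), u (Suc i)) \<or> phase_step (x (Suc i), u (Suc i)) (x i, u i)"
    and closed: "x n = x 0"
  shows "u n = u 0"
proof -
  have xm: "x (Suc i mod n) = x (Suc i)" if "i < n" for i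
    using that closed by (cases "Suc i = n") auto
  have "\<exists>T r c. T \<in> \<U> \<and> entry T (x c) (x r) = 1 \<and>
      (c = i \<and> r = Suc i mod n \<and> image_entry T (x c) (x r) = u (Suc i) * cnj (u i) \<or>
       c = Suc i mod n \<and> r = i \<and> image_entry T (x c) (x r) = u i * cnj (u (Suc i)))" if i: "i < n" for i
    using step[OF i]
  proof
    assume "phase_step (x i, u i) (x (Suc i), u (Suc i))"
    then obtain T where "T \<in> \<U>" "entry T (x i) (x (Suc i)) = 1" "image_entry T (x i) (x (Suc i)) = u (Suc i) * cnj (u i)"
      by (rule phase_step_normalized)
    then show ?thesis using xm[OF i] by metis
  next
    assume "phase_step (x (Suc i), u (Suc i)) (x i, u i)"
    then obtain T where "T \<in> \<U>" "entry T (x (Suc i)) (x i) = 1" "image_entry T (x (Suc i)) (x i) = u i * cnj (u (Suc i))"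
      by (rule phase_step_normalized)
    then show ?thesis using xm[OF i] by metis
  qed
  then obtain T r c where Trc: "\<And>i. i < n \<Longrightarrow> T i \<in> \<U>" "\<And>i. i < n \<Longrightarrow> entry (T i) (x (c i)) (x (r i)) = 1"
      "\<And>i. i < n \<Longrightarrow> c i = i \<and> r i = Suc i mod n \<and> image_entry (T i) (x (c i)) (x (r i)) = u (Suc i) * cnj (u i) \<or>
       c i = Suc i mod n \<and> r i = i \<and> image_entry (T i) (x (c i)) (x (r i)) = u i * cnj (u (Suc i))"
    by metis
  have rc: "r i < n \<and> c i < n" if "i < n" for i
    using Trc(3)[OF that] that n by auto
  define K where "K = 1 - (cmod (u n - u 0))\<^sup>2 / (2 * (real n)\<^sup>2)"
  have K: "Re (\<Sum>s<n. cnj (a (r s)) * a (c s) * cinner (blinfun_apply (\<theta> (T s)) (peak (x (c s)))) (peak (x (r s))))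
      \<le> K * (\<Sum>j<n. (cmod (a j))\<^sup>2)" for a
  proof -
    have "Re (cnj (a (r s)) * a (c s) * image_entry (T s) (x (c s)) (x (r s)))
        = Re ((cnj (u s) * a s) * cnj (cnj (u (Suc s)) * a (Suc s mod n)))" if "s < n" for s
      using Trc(3)[OF that] by (auto simp: algebra_simps)
    then have "Re (\<Sum>s<n. cnj (a (r s)) * a (c s) * image_entry (T s) (x (c s)) (x (r s)))
        = (\<Sum>s<n. Re ((cnj (u s) * a s) * cnj (cnj (u (Suc s)) * a (Suc s mod n))))"
      unfolding Re_sum by (intro sum.cong) auto
    moreover have "\<dots> \<le> K * (\<Sum>j<n. (cmod (a j))\<^sup>2)"
      unfolding K_def by (rule cyclic_phase_gap[OF n]) (rule u)
    ultimately show ?thesis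
      by (simp only: image_entry_def)
  qed
  let ?a = "\<lambda>_::nat. complex_of_real (1 / sqrt (real n))"
  have a: "(\<Sum>j<n. (cmod (?a j))\<^sup>2) = 1"
    using n by (simp add: norm_divide power_divide)
  have "Re (\<Sum>s<n. cnj (?a (r s)) * ?a (c s) * cinner (blinfun_apply (\<psi> (\<theta> (T s))) (ket (x (c s)))) (ket (x (r s)))) \<le> K"
    by (rule bwd.entries_compression_le[where P = "\<lambda>j. \<theta> (ket_proj \<Gamma> (x j))" and v = "\<lambda>j. peak (x j)" and w = "\<lambda>j. ket (x j)"
          and T = "\<lambda>s. \<theta> (T s)" and r = r and c = c, OF _ _ _ _ _ _ _ _ _ K a])
      (simp_all add: x peak image_apply \<theta>_mem ket_proj_mem_dom ket_in_ell2_on inverse_image_fixes_ket rc Trc(1))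
  also have "(\<Sum>s<n. cnj (?a (r s)) * ?a (c s) * cinner (blinfun_apply (\<psi> (\<theta> (T s))) (ket (x (c s)))) (ket (x (r s))))
      = (\<Sum>s<n. complex_of_real (1 / real n))"
  proof (rule sum.cong)
    fix s assume "s \<in> {..<n}"
    then have "s < n" by simp
    then show "cnj (?a (r s)) * ?a (c s) * cinner (blinfun_apply (\<psi> (\<theta> (T s))) (ket (x (c s)))) (ket (x (r s))) = complex_of_real (1 / real n)"
      using Trc(2)[of s] n by (simp add: inv_left Trc(1) entry_def flip: of_real_mult)
  qed simp
  finally have "1 \<le> K" using n by simp
  then show ?thesis
    using n by (simp add: K_def field_simps)
qed

definition phase_eq :: "'a \<times> complex \<Rightarrow> 'a \<times> complex \<Rightarrow> bool" where
  "phase_eq = equivclp phase_step"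

lemma phase_eq_norm: "phase_eq p q \<Longrightarrow> cmod (snd p) = cmod (snd q)"
  unfolding phase_eq_def
  by (induction rule: equivclp_induct) (auto simp: phase_step_def)

lemma phase_eq_unique:
  assumes "phase_eq (x, u) (x, v)"
  shows "u = v"
proof -
  obtain n f where f: "f 0 = (x, u)" "f n = (x, v)" "\<And>i. i < n \<Longrightarrow> symclp phase_step (f i) (f (Suc i))"
    using assms unfolding phase_eq_def equivclp_def
    by (auto dest!: rtranclp_imp_relpowp simp: relpowp_fun_conv)
  show ?thesis
  proof (cases "n = 0")
    case False
    have "fst (f i) \<in> \<Gamma> \<and> cmod (snd (f i)) = 1" if "i \<le> n" for i
    proof (cases "i = n")
      case True
      then show ?thesis
        using f(3)[of "n - 1"] False by (auto simp: symclp_def phase_step_def)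
    next
      case False
      then show ?thesis
        using f(3)[of i] that by (auto simp: symclp_def phase_step_def)
    qed
    then have "snd (f n) = snd (f 0)"
      using False f by (intro phase_cycle[where x = "\<lambda>i. fst (f i)"]) (auto simp: symclp_def)
    then show ?thesis using f by simp
  qed (use f in simp)
qed

text \<open>
  In each class of points connected by steps, fix one reference point \<open>r\<close> with phase one and
  follow any walk to \<open>x\<close>; the phase obtained there does not depend on the walk. Where the
  entry of \<open>T\<close> vanishes, so does the image entry, having the same modulus.
\<close>

lemma phase_gauge:
  obtains g where "\<And>x. x \<in> \<Gamma> \<Longrightarrow> cmod (g x) = 1"
    "\<And>x z T. \<lbrakk>x \<in> \<Gamma>; z \<in> \<Gamma>; T \<in> \<U>\<rbrakk> \<Longrightarrow> g z * entry T x z = g x * image_entry T x z"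
proof -
  define r where "r = (\<lambda>x. SOME r. \<exists>u. phase_eq (r, 1) (x, u))"
  define g where "g = (\<lambda>x. SOME u. phase_eq (r x, 1) (x, u))"
  have g: "phase_eq (r x, 1) (x, g x)" for x
  proof -
    have "\<exists>r u. phase_eq (r, 1) (x, u)"
      by (rule exI[of _ x], rule exI[of _ 1]) (simp add: phase_eq_def equivclp_def)
    then have "\<exists>u. phase_eq (r x, 1) (x, u)"
      unfolding r_def by (rule someI_ex)
    then show ?thesis
      unfolding g_def by (rule someI_ex)
  qed
  have g1: "cmod (g x) = 1" for x
    using phase_eq_norm[OF g, of x] by simp
  have trans: "phase_eq p q \<Longrightarrow> phase_eq q s \<Longrightarrow> phase_eq p s" for p q s
    unfolding phase_eq_def by (rule transpD[OF transp_equivclp])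
  have sym: "phase_eq p q \<Longrightarrow> phase_eq q p" for p q
    unfolding phase_eq_def by (rule equivclp_sym)
  show thesis
  proof (rule that[of g])
    fix x z T assume x: "x \<in> \<Gamma>" and z: "z \<in> \<Gamma>" and T: "T \<in> \<U>"
    show "g z * entry T x z = g x * image_entry T x z"
    proof (cases "entry T x z = 0")
      case True
      then show ?thesis using norm_image_entry[OF x z T] by simp
    next
      case False
      define \<phi> where "\<phi> = image_entry T x z / entry T x z"
      have \<phi>: "cmod \<phi> = 1" "image_entry T x z = \<phi> * entry T x z"
        using False norm_image_entry[OF x z T] by (simp_all add: \<phi>_def norm_divide)
      have step: "phase_eq (x, u) (z, u * \<phi>)" if "cmod u = 1" for u
      proof -
        have "phase_step (x, u) (z, u * \<phi>)"
          unfolding phase_step_def using x z T False \<phi> that by (auto simp: norm_mult intro!: bexI[of _ T])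
        then show ?thesis
          unfolding phase_eq_def equivclp_def by (intro r_into_rtranclp symclpI1)
      qed
      have "(\<exists>u. phase_eq (r, 1) (x, u)) = (\<exists>u. phase_eq (r, 1) (z, u))" for r
      proof
        assume "\<exists>u. phase_eq (r, 1) (x, u)"
        then obtain u where u: "phase_eq (r, 1) (x, u)" by blast
        show "\<exists>u. phase_eq (r, 1) (z, u)"
          using trans[OF u step] phase_eq_norm[OF u] by auto
      next
        assume "\<exists>u. phase_eq (r, 1) (z, u)"
        then obtain u where u: "phase_eq (r, 1) (z, u)" by blast
        have "phase_eq (x, u / \<phi>) (z, u / \<phi> * \<phi>)"
          using step[of "u / \<phi>"] phase_eq_norm[OF u] \<phi>(1) by (simp add: norm_divide)
        moreover have "u / \<phi> * \<phi> = u"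
          using \<phi>(1) by auto
        ultimately have "phase_eq (z, u) (x, u / \<phi>)"
          by (simp add: sym)
        then show "\<exists>u. phase_eq (r, 1) (x, u)"
          using trans[OF u] by blast
      qed
      then have "r x = r z"
        by (simp add: r_def)
      then have "phase_eq (z, g z) (z, g x * \<phi>)"
        using trans[OF sym[OF g[of z]] trans[OF _ step[OF g1[of x]]]] g[of x] by simp
      then show ?thesis
        using phase_eq_unique \<phi>(2) by (metis mult.assoc)
    qed
  qed (rule g1)
qed

end


section \<open>Coefficient operators of orthonormal families\<close>

lemma Bessel_inequality:
  assumes F: "finite F" and on: "\<And>i j. i \<in> F \<Longrightarrow> j \<in> F \<Longrightarrow> cinner (b i) (b j) = (if i = j then 1 else 0)"
  shows "(\<Sum>i\<in>F. (cmod (cinner g (b i)))\<^sup>2) \<le> (norm g)\<^sup>2"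
proof -
  let ?s = "\<Sum>i\<in>F. (cmod (cinner g (b i)))\<^sup>2" and ?p = "\<Sum>i\<in>F. cinner g (b i) *\<^sub>C b i"
  have gp: "cinner g ?p = complex_of_real ?s"
    by (simp add: cinner_sum_right cinner_scaleC_right complex_norm_square mult.commute del: of_real_power)
  have "cinner (b i) ?p = cnj (cinner g (b i))" if "i \<in> F" for i
  proof -
    have "cinner (b i) ?p = (\<Sum>j\<in>F. if i = j then cnj (cinner g (b j)) else 0)"
      unfolding cinner_sum_right by (rule sum.cong) (use that in \<open>auto simp: on cinner_scaleC_right\<close>)
    then show ?thesis using F that by simp
  qed
  then have "cinner ?p ?p = complex_of_real ?s"
    by (subst cinner_sum_left) (simp add: cinner_scaleC_left complex_norm_square del: of_real_power)
  then have "(norm ?p)\<^sup>2 = ?s"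
    by (metis cinner_self_norm of_real_eq_iff)
  then have "(norm (g - ?p))\<^sup>2 = (norm g)\<^sup>2 - ?s"
    using norm_sq_add[of g "- ?p"] gp by (simp add: cinner_minus_right)
  then show ?thesis
    using zero_le_power2[of "norm (g - ?p)"] by linarith
qed

definition orthonormal_on :: "'i set \<Rightarrow> ('i \<Rightarrow> 'c ell2) \<Rightarrow> bool" where
  "orthonormal_on I b \<longleftrightarrow> (\<forall>i\<in>I. \<forall>j\<in>I. cinner (b i) (b j) = (if i = j then 1 else 0))"

definition coeff_op :: "'i set \<Rightarrow> ('i \<Rightarrow> 'c ell2) \<Rightarrow> ('c ell2 \<Rightarrow>\<^sub>L 'i ell2)" where
  "coeff_op I b = Blinfun (\<lambda>g. Abs_ell2 (\<lambda>i. if i \<in> I then cinner g (b i) else 0))"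

lemma coeff_op:
  assumes on: "orthonormal_on I b"
  shows ell2_fun_coeff_op: "ell2_fun (blinfun_apply (coeff_op I b) g) i = (if i \<in> I then cinner g (b i) else 0)"
    and norm_coeff_op_le: "norm (blinfun_apply (coeff_op I b) g) \<le> norm g"
proof -
  define V where "V = (\<lambda>g. Abs_ell2 (\<lambda>i. if i \<in> I then cinner g (b i) else 0))"
  have le: "(\<Sum>i\<in>F. (cmod (if i \<in> I then cinner g (b i) else 0))\<^sup>2) \<le> (norm g)\<^sup>2" if F: "finite F" for F g
  proof -
    have "(\<Sum>i\<in>F. (cmod (if i \<in> I then cinner g (b i) else 0))\<^sup>2) = (\<Sum>i\<in>F \<inter> I. (cmod (cinner g (b i)))\<^sup>2)"
      by (rule sum.mono_neutral_cong_right) (use F in auto)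
    also have "\<dots> \<le> (norm g)\<^sup>2"
      by (rule Bessel_inequality) (use F on in \<open>auto simp: orthonormal_on_def\<close>)
    finally show ?thesis .
  qed
  have summable: "(\<lambda>i. (cmod (if i \<in> I then cinner g (b i) else 0))\<^sup>2) summable_on UNIV" for g
    by (rule nonneg_bdd_above_summable_on) (use le in \<open>auto intro!: bdd_aboveI2\<close>)
  have V: "ell2_fun (V g) i = (if i \<in> I then cinner g (b i) else 0)" for g i
    unfolding V_def by (subst Abs_ell2_inverse) (use summable in auto)
  have norm_V: "norm (V g) \<le> norm g" for g
  proof -
    have "(norm (V g))\<^sup>2 \<le> (norm g)\<^sup>2"
      unfolding norm_sq_infsum[of "V g"] V by (rule infsum_le_finite_sums[OF summable le])
    then show ?thesis by (simp add: power2_le_iff_abs_le)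
  qed
  have "bounded_linear V"
  proof (rule bounded_linear_intro[where K = 1])
    show "V (f + g) = V f + V g" for f g
      by (rule ell2_eqI) (simp add: V plus_ell2.rep_eq cinner_add_left)
    show "V (r *\<^sub>R f) = r *\<^sub>R V f" for r f
      by (rule ell2_eqI) (simp add: V scaleR_eq_scaleC scaleC.rep_eq cinner_scaleC_left)
  qed (simp add: norm_V)
  then have "blinfun_apply (coeff_op I b) g = V g" for g
    unfolding coeff_op_def V_def[symmetric] by (simp add: bounded_linear_Blinfun_apply)
  then show "ell2_fun (blinfun_apply (coeff_op I b) g) i = (if i \<in> I then cinner g (b i) else 0)"
    "norm (blinfun_apply (coeff_op I b) g) \<le> norm g"
    using V norm_V by auto
qed

lemma coeff_op_mem:
  assumes on: "orthonormal_on I b" and b: "\<And>i. i \<in> I \<Longrightarrow> b i \<in> ell2_on \<Delta>"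
  shows "coeff_op I b \<in> bounded_ops \<Delta> I"
proof -
  have "cinner f (b i) = 0" if "f \<in> ell2_on (- \<Delta>)" "i \<in> I" for f i
    unfolding cinner_def by (rule infsum_0) (use that b[of i] in \<open>auto simp: ell2_on_def\<close>)
  then show ?thesis
    unfolding bounded_ops_def ell2_on_def[of I]
    by (auto intro!: ell2_eqI simp: ell2_fun_coeff_op[OF on] scaleC.rep_eq cinner_scaleC_left zero_ell2.rep_eq)
qed

text \<open>
  By the Bessel inequality, \<open>\<langle>f, g\<rangle> - \<langle>V f, V g\<rangle>\<close> is a nonnegative form; completeness says that it
  vanishes at each \<open>ket y\<close>.
\<close>

lemma coeff_op_isometric:
  assumes on: "orthonormal_on I b" and complete: "\<And>y. y \<in> \<Delta> \<Longrightarrow> ((\<lambda>i. (cmod (ell2_fun (b i) y))\<^sup>2) has_sum 1) I"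
    and f: "f \<in> ell2_on \<Delta>" and g: "g \<in> ell2_on \<Delta>"
  shows "cinner (blinfun_apply (coeff_op I b) f) (blinfun_apply (coeff_op I b) g) = cinner f g"
proof -
  let ?V = "blinfun_apply (coeff_op I b)"
  define D where "D = (\<lambda>f g. cinner f g - cinner (?V f) (?V g))"
  have lin: "?V (c *\<^sub>C f) = c *\<^sub>C ?V f" for c f
    by (rule ell2_eqI) (simp add: ell2_fun_coeff_op[OF on] scaleC.rep_eq cinner_scaleC_left)
  have "D f g = 0"
  proof (rule nonneg_form_eq_0[where \<Gamma> = \<Delta>])
    show "bounded_linear (D f)" for f
      unfolding D_def
      by (intro bounded_linear_sub bounded_linear_cinner_right
          bounded_linear_compose[OF bounded_linear_cinner_right blinfun.bounded_linear_right])
    show "Im (D f f) = 0 \<and> 0 \<le> Re (D f f)" for f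
      using power_mono[OF norm_coeff_op_le[OF on, of f], of 2] by (simp add: D_def cinner_self_norm del: of_real_power)
    fix y assume y: "y \<in> \<Delta>"
    have "(norm (?V (ket y)))\<^sup>2 = (\<Sum>\<^sub>\<infinity>i. (cmod (if i \<in> I then cinner (ket y) (b i) else 0))\<^sup>2)"
      by (simp only: norm_sq_infsum ell2_fun_coeff_op[OF on])
    also have "\<dots> = (\<Sum>\<^sub>\<infinity>i\<in>I. (cmod (ell2_fun (b i) y))\<^sup>2)"
      by (rule infsum_cong_neutral) (auto simp: cinner_ket_left)
    also have "\<dots> = 1"
      by (rule infsumI[OF complete[OF y]])
    finally show "D (ket y) (ket y) = 0"
      by (simp add: D_def cinner_self_norm)
  qed (use f g in \<open>simp_all add: D_def blinfun.add_right cinner_add_left cinner_add_right lin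
      cinner_scaleC_left cinner_scaleC_right algebra_simps\<close>)
  then show ?thesis by (simp add: D_def)
qed

text \<open>
  The adjoint is obtained as another coefficient operator: if \<open>V\<close> is the coefficient operator of
  \<open>b\<close>, then the vectors \<open>V (ket y)\<close> are orthonormal, and the coefficient operator that they define
  is adjoint to \<open>V\<close>.
\<close>

lemma unitary_from_orthonormal_basis:
  fixes b :: "'i \<Rightarrow> 'c ell2"
  assumes on: "orthonormal_on I b" and b: "\<And>i. i \<in> I \<Longrightarrow> b i \<in> ell2_on \<Delta>"
    and complete: "\<And>y. y \<in> \<Delta> \<Longrightarrow> ((\<lambda>i. (cmod (ell2_fun (b i) y))\<^sup>2) has_sum 1) I"
  obtains W where "unitary_op I \<Delta> W" "adj W = coeff_op I b" "\<And>i. i \<in> I \<Longrightarrow> blinfun_apply W (ket i) = b i"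
proof -
  define V where "V = coeff_op I b"
  have V: "ell2_fun (blinfun_apply V g) i = (if i \<in> I then cinner g (b i) else 0)" for g i
    unfolding V_def by (rule ell2_fun_coeff_op[OF on])
  have iso: "cinner (blinfun_apply V f) (blinfun_apply V g) = cinner f g" if "f \<in> ell2_on \<Delta>" "g \<in> ell2_on \<Delta>" for f g
    unfolding V_def by (rule coeff_op_isometric[OF on complete that])
  have Vmem: "V \<in> bounded_ops \<Delta> I"
    unfolding V_def by (rule coeff_op_mem[OF on b])
  have V_id: "blinfun_apply V (blinfun_apply (id_op \<Delta>) g) = blinfun_apply V g" for g
    by (rule ell2_eqI) (simp add: V cinner_id_op b)
  have V_on: "blinfun_apply V g \<in> ell2_on I" for g
    by (simp add: ell2_on_def V)
  have on': "orthonormal_on \<Delta> (\<lambda>y. blinfun_apply V (ket y))"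
    by (simp add: orthonormal_on_def iso ket_in_ell2_on cinner_ket ket.rep_eq)
  define W where "W = coeff_op \<Delta> (\<lambda>y. blinfun_apply V (ket y))"
  have W: "ell2_fun (blinfun_apply W f) y = (if y \<in> \<Delta> then cinner f (blinfun_apply V (ket y)) else 0)" for f y
    unfolding W_def by (rule ell2_fun_coeff_op[OF on'])
  have Wmem: "W \<in> bounded_ops I \<Delta>"
    unfolding W_def by (rule coeff_op_mem[OF on' V_on])
  have W_on: "blinfun_apply W f \<in> ell2_on \<Delta>" for f
    by (simp add: ell2_on_def W)
  have Wket: "blinfun_apply W (ket i) = b i" if "i \<in> I" for i
  proof (rule ell2_eqI)
    show "ell2_fun (blinfun_apply W (ket i)) y = ell2_fun (b i) y" for y
      using b[OF that] that by (auto simp: W V cinner_ket_left ell2_on_def)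
  qed
  have adjoint: "cinner (blinfun_apply W f) g = cinner f (blinfun_apply V g)" for f g
  proof -
    have lin: "blinfun_apply V (c *\<^sub>C g) = c *\<^sub>C blinfun_apply V g" for c g
      by (rule ell2_eqI) (simp add: V scaleC.rep_eq cinner_scaleC_left)
    define G where "G = (\<lambda>g. cinner (blinfun_apply W f) g - cinner f (blinfun_apply V g))"
    have "G (blinfun_apply (id_op \<Delta>) g) = 0"
    proof (rule bounded_linear_eq_0_on_ell2_on[OF _ _ id_op_in_ell2_on])
      show "bounded_linear G"
        unfolding G_def
        by (intro bounded_linear_sub bounded_linear_cinner_right
            bounded_linear_compose[OF bounded_linear_cinner_right blinfun.bounded_linear_right])
      show "G (c *\<^sub>C ket y) = 0" if "y \<in> \<Delta>" for y c
        using that by (simp add: G_def lin cinner_scaleC_right cinner_ket W)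
    qed
    then show ?thesis
      using cinner_id_op[OF W_on[of f], of g] cinner_commute[of "blinfun_apply W f"]
      by (simp add: G_def V_id)
  qed
  then have adjW: "adj W = V"
    by (rule adj_eqI)
  have "V o\<^sub>L W = id_op I"
  proof (rule blinfun_eqI, rule ell2_eqI)
    fix f i
    have "cinner (blinfun_apply W f) (b i) = ell2_fun f i" if i: "i \<in> I"
    proof -
      have "blinfun_apply V (b i) = ket i"
        by (rule ell2_eqI) (use i on in \<open>auto simp: V orthonormal_on_def ket.rep_eq\<close>)
      then show ?thesis by (simp add: adjoint cinner_ket)
    qed
    then show "ell2_fun (blinfun_apply (V o\<^sub>L W) f) i = ell2_fun (blinfun_apply (id_op I) f) i"
      by (simp add: V ell2_fun_id_op)
  qed
  moreover have "W o\<^sub>L V = id_op \<Delta>"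
  proof (rule blinfun_eqI, rule ell2_eqI)
    fix g y
    have "cinner (blinfun_apply V g) (blinfun_apply V (ket y)) = ell2_fun (blinfun_apply (id_op \<Delta>) g) y" if "y \<in> \<Delta>"
      using iso[OF id_op_in_ell2_on ket_in_ell2_on[OF that], of g] by (simp add: V_id cinner_ket)
    then show "ell2_fun (blinfun_apply (W o\<^sub>L V) g) y = ell2_fun (blinfun_apply (id_op \<Delta>) g) y"
      by (simp add: W ell2_fun_id_op)
  qed
  ultimately have "unitary_op I \<Delta> W"
    using Wmem adjW by (simp add: unitary_op_def)
  then show thesis
    using that[of W] adjW Wket by (simp add: V_def)
qed


section \<open>The unitary equivalence\<close>

text \<open>
  The gauge phases make the entries of \<open>\<theta> T\<close> in the basis \<open>g x *\<^sub>C peak x\<close> equal to those of \<open>T\<close> in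
  the basis \<open>ket x\<close>, so \<open>W\<^sup>* \<theta>(T) W\<close> and \<open>T\<close> agree on basis vectors.
\<close>

lemma (in masa_isomorphism) unitary_equivalence:
  "\<exists>W. unitary_op \<Gamma> \<Delta> W \<and> (\<forall>T\<in>\<U>. \<theta> T = W o\<^sub>L T o\<^sub>L adj W)"
proof -
  obtain g where g: "\<And>x. x \<in> \<Gamma> \<Longrightarrow> cmod (g x) = 1"
    "\<And>x z T. \<lbrakk>x \<in> \<Gamma>; z \<in> \<Gamma>; T \<in> \<U>\<rbrakk> \<Longrightarrow> g z * entry T x z = g x * image_entry T x z"
    by (rule phase_gauge) (rule that)
  define b where "b = (\<lambda>x. g x *\<^sub>C peak x)"
  have gg: "cnj (g x) * g x = 1" if "x \<in> \<Gamma>" for x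
    using complex_norm_square[of "g x"] g(1)[OF that] by (simp add: mult.commute)
  have on: "orthonormal_on \<Gamma> b"
    using gg by (auto simp: orthonormal_on_def b_def cinner_scaleC_left cinner_scaleC_right peak_orthonormal mult.commute)
  have b: "b x \<in> ell2_on \<Delta>" if "x \<in> \<Gamma>" for x
    unfolding b_def by (rule ell2_on_scaleC[OF peak(2)[OF that]])
  have complete: "((\<lambda>x. (cmod (ell2_fun (b x) y))\<^sup>2) has_sum 1) \<Gamma>" if "y \<in> \<Delta>" for y
  proof -
    have "(cmod (ell2_fun (b x) y))\<^sup>2 = (cmod (ell2_fun (peak x) y))\<^sup>2" if "x \<in> \<Gamma>" for x
      by (simp add: b_def scaleC.rep_eq norm_mult g(1)[OF that])
    then show ?thesis
      using peak_complete[OF that] by (subst has_sum_cong) auto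
  qed
  obtain W where W: "unitary_op \<Gamma> \<Delta> W" "adj W = coeff_op \<Gamma> b" "\<And>x. x \<in> \<Gamma> \<Longrightarrow> blinfun_apply W (ket x) = b x"
    using unitary_from_orthonormal_basis[OF on b complete] by blast
  have WV: "blinfun_apply W (blinfun_apply (adj W) \<eta>) = blinfun_apply (id_op \<Delta>) \<eta>" for \<eta>
    using W(1) unfolding unitary_op_def by (metis blinfun_apply_blinfun_compose)
  have Wlin: "blinfun_apply W (c *\<^sub>C f) = c *\<^sub>C blinfun_apply W f" for c f
    using W(1) by (simp add: unitary_op_def bounded_ops_def)
  have "\<theta> T = W o\<^sub>L T o\<^sub>L adj W" if T: "T \<in> \<U>" for T
  proof -
    have V: "ell2_fun (blinfun_apply (adj W) f) x = (if x \<in> \<Gamma> then cinner f (b x) else 0)" for f x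
      unfolding W(2) by (rule ell2_fun_coeff_op[OF on])
    have Vlin: "blinfun_apply (adj W) (c *\<^sub>C f) = c *\<^sub>C blinfun_apply (adj W) f" for c f
      by (rule ell2_eqI) (simp add: V scaleC.rep_eq cinner_scaleC_left)
    define G where "G = (adj W o\<^sub>L \<theta> T o\<^sub>L W) - T"
    have ket0: "blinfun_apply G (ket x) = 0" if x: "x \<in> \<Gamma>" for x
    proof (rule ell2_eqI)
      fix z
      have "cinner (blinfun_apply (\<theta> T) (b x)) (b z) = ell2_fun (blinfun_apply T (ket x)) z" if z: "z \<in> \<Gamma>"
      proof -
        have "cinner (blinfun_apply (\<theta> T) (b x)) (b z) = cnj (g z) * (g x * image_entry T x z)"
          by (simp add: b_def \<theta>_linear[OF T] cinner_scaleC_left cinner_scaleC_right image_entry_def)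
        also have "\<dots> = (cnj (g z) * g z) * entry T x z"
          by (simp add: g(2)[OF x z T, symmetric])
        finally show ?thesis
          by (simp add: gg[OF z] entry_def cinner_ket)
      qed
      moreover have "ell2_fun (blinfun_apply T (ket x)) z = 0" if "z \<notin> \<Gamma>"
        using operator_space_range[OF fwd.os T, of "ket x"] that by (simp add: ell2_on_def)
      ultimately show "ell2_fun (blinfun_apply G (ket x)) z = ell2_fun 0 z"
        by (simp add: G_def blinfun.diff_left ell2_fun_diff V W(3)[OF x] zero_ell2.rep_eq)
    qed
    have Glin: "blinfun_apply G (c *\<^sub>C f) = c *\<^sub>C blinfun_apply G f" for c f
      by (simp add: G_def blinfun.diff_left Wlin Vlin \<theta>_linear[OF T] operator_space_linear[OF fwd.os T] scaleC_diff_right)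
    have "blinfun_apply G f = 0" if "f \<in> ell2_on \<Gamma>" for f
      by (rule bounded_linear_eq_0_on_ell2_on[OF blinfun.bounded_linear_right _ that]) (simp add: Glin ket0)
    then have *: "blinfun_apply (adj W) (blinfun_apply (\<theta> T) (blinfun_apply W f)) = blinfun_apply T f" if "f \<in> ell2_on \<Gamma>" for f
      using that by (simp add: G_def blinfun.diff_left)
    show ?thesis
    proof (rule blinfun_eqI)
      fix \<eta>
      have "blinfun_apply T (blinfun_apply (adj W) \<eta>)
          = blinfun_apply (adj W) (blinfun_apply (\<theta> T) (blinfun_apply W (blinfun_apply (adj W) \<eta>)))"
        by (rule *[symmetric]) (simp add: ell2_on_def V)
      then have "blinfun_apply W (blinfun_apply T (blinfun_apply (adj W) \<eta>))
          = blinfun_apply (id_op \<Delta>) (blinfun_apply (\<theta> T) (blinfun_apply (id_op \<Delta>) \<eta>))"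
        by (simp add: WV)
      also have "\<dots> = blinfun_apply (\<theta> T) \<eta>"
        by (simp add: operator_space_id_op[OF bwd.os \<theta>_mem[OF T]] id_op_apply \<theta>_range[OF T])
      finally show "blinfun_apply (\<theta> T) \<eta> = blinfun_apply (W o\<^sub>L T o\<^sub>L adj W) \<eta>"
        by simp
    qed
  qed
  then show ?thesis using W(1) by blast
qed

lemma complete_isometry_inj_on:
  fixes \<U> :: "('a ell2 \<Rightarrow>\<^sub>L 'a ell2) set"
  assumes ci: "complete_isometry \<U> \<V> \<theta>" and os: "operator_space \<Gamma> \<U>"
  shows "inj_on \<theta> \<U>"
proof (rule inj_onI)
  fix S T assume S: "S \<in> \<U>" and T: "T \<in> \<U>" and eq: "\<theta> S = \<theta> T"
  let ?D = "S + scale_op (- 1) T"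
  have D: "?D \<in> \<U>"
    by (intro operator_space_add[OF os] operator_space_scale[OF os] S T)
  have D0: "\<theta> ?D = 0"
    by (rule blinfun_eqI) (simp add: complete_isometry_add[OF ci] complete_isometry_scale[OF ci]
        operator_space_scale[OF os] S T eq blinfun.add_left scaleC_minus_left)
  show "S = T"
  proof (rule blinfun_eqI)
    fix \<xi> :: "'a ell2"
    define c where "c = complex_of_real (1 / (1 + norm \<xi>))"
    define \<zeta> where "\<zeta> = c *\<^sub>C \<xi>"
    have pos: "0 < 1 + norm \<xi>" by (simp add: add_pos_nonneg)
    then have c: "cmod c = 1 / (1 + norm \<xi>)"
      unfolding c_def norm_of_real by simp
    have "norm \<zeta> \<le> 1"
      using pos by (simp add: \<zeta>_def norm_scaleC c)
    then have "(\<Sum>j<1::nat. (norm \<zeta>)\<^sup>2) \<le> 1"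
      by (simp add: power_le_one)
    then have "(\<Sum>i<1::nat. (norm (\<Sum>j<1::nat. blinfun_apply ?D \<zeta>))\<^sup>2) \<le> (matrix_op_norm 1 (\<lambda>_ _. ?D))\<^sup>2"
      by (rule matrix_op_norm_lower)
    also have "matrix_op_norm 1 (\<lambda>_ _. ?D) = matrix_op_norm 1 (\<lambda>_ _. \<theta> ?D)"
      by (rule complete_isometry_norm[OF ci D, symmetric])
    also have "(matrix_op_norm 1 (\<lambda>_ _. \<theta> ?D))\<^sup>2 \<le> 0"
      unfolding D0 by (rule matrix_op_norm_upper) simp
    finally have "blinfun_apply ?D \<zeta> = 0" by simp
    then have "norm (c *\<^sub>C blinfun_apply ?D \<xi>) = 0"
      by (simp only: \<zeta>_def operator_space_linear[OF os D] norm_zero)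
    then have "norm (blinfun_apply ?D \<xi>) = 0"
      unfolding norm_scaleC c using pos by simp
    then show "blinfun_apply S \<xi> = blinfun_apply T \<xi>"
      by (simp add: blinfun.add_left scaleC_minus_left)
  qed
qed

lemma complete_isometry_inverse:
  assumes ci: "complete_isometry \<U> \<V> \<theta>" and os: "operator_space \<Gamma> \<U>" and surj: "\<theta> ` \<U> = \<V>"
  shows "complete_isometry \<V> \<U> (inv_into \<U> \<theta>)"
proof -
  let ?\<psi> = "inv_into \<U> \<theta>"
  have inj: "inj_on \<theta> \<U>" by (rule complete_isometry_inj_on[OF ci os])
  have mem: "?\<psi> S \<in> \<U>" and inv: "\<theta> (?\<psi> S) = S" if "S \<in> \<V>" for S
    using that surj by (auto intro: inv_into_into f_inv_into_f)
  have eqI: "?\<psi> S = T" if "T \<in> \<U>" "\<theta> T = S" for S T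
    using that inj by auto
  show ?thesis
    unfolding complete_isometry_def
  proof (intro conjI ballI allI impI)
    show "?\<psi> (S + T) = ?\<psi> S + ?\<psi> T" if "S \<in> \<V>" "T \<in> \<V>" for S T
      using that by (intro eqI) (simp_all add: operator_space_add[OF os] mem complete_isometry_add[OF ci] inv)
    show "?\<psi> (scale_op c T) = scale_op c (?\<psi> T)" if "T \<in> \<V>" for c T
      using that by (intro eqI) (simp_all add: operator_space_scale[OF os] mem complete_isometry_scale[OF ci] inv)
    fix n :: nat and A
    assume A: "\<forall>i<n. \<forall>j<n. A i j \<in> \<V>"
    then have "matrix_op_norm n (\<lambda>i j. \<theta> (?\<psi> (A i j))) = matrix_op_norm n (\<lambda>i j. ?\<psi> (A i j))"
      by (intro complete_isometry_norm[OF ci]) (simp add: mem)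
    moreover have "matrix_op_norm n (\<lambda>i j. \<theta> (?\<psi> (A i j))) = matrix_op_norm n A"
      unfolding matrix_op_norm_def
      by (intro SUP_cong refl arg_cong[where f = sqrt] sum.cong arg_cong[where f = "\<lambda>z. (norm z)\<^sup>2"])
        (simp add: A inv)
    ultimately show "matrix_op_norm n (\<lambda>i j. ?\<psi> (A i j)) = matrix_op_norm n A" by simp
  qed (rule mem)
qed

theorem theorem2p10:
  fixes \<Gamma>\<^sub>1 :: "'a set" and \<Gamma>\<^sub>2 :: "'b set"
    and \<U>\<^sub>1 :: "('a ell2 \<Rightarrow>\<^sub>L 'a ell2) set" and \<U>\<^sub>2 :: "('b ell2 \<Rightarrow>\<^sub>L 'b ell2) set"
    and \<theta> :: "('a ell2 \<Rightarrow>\<^sub>L 'a ell2) \<Rightarrow> ('b ell2 \<Rightarrow>\<^sub>L 'b ell2)"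
  assumes "unital_operator_space \<Gamma>\<^sub>1 \<U>\<^sub>1" and "unital_operator_space \<Gamma>\<^sub>2 \<U>\<^sub>2"
    and "linfty_ops \<Gamma>\<^sub>1 \<subseteq> \<U>\<^sub>1" and "linfty_ops \<Gamma>\<^sub>2 \<subseteq> \<U>\<^sub>2"
    and "complete_isometry \<U>\<^sub>1 \<U>\<^sub>2 \<theta>"
    and "\<theta> ` \<U>\<^sub>1 = \<U>\<^sub>2"
    and "\<theta> (id_op \<Gamma>\<^sub>1) = id_op \<Gamma>\<^sub>2"
  shows "\<exists>W. unitary_op \<Gamma>\<^sub>1 \<Gamma>\<^sub>2 W \<and> (\<forall>T\<in>\<U>\<^sub>1. \<theta> T = W o\<^sub>L T o\<^sub>L adj W)"
proof -
  let ?\<psi> = "inv_into \<U>\<^sub>1 \<theta>"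
  have os: "operator_space \<Gamma>\<^sub>1 \<U>\<^sub>1" and id: "id_op \<Gamma>\<^sub>1 \<in> \<U>\<^sub>1"
    using assms(1) by (auto simp: unital_operator_space_def)
  have inj: "inj_on \<theta> \<U>\<^sub>1"
    by (rule complete_isometry_inj_on[OF assms(5) os])
  have "masa_isomorphism \<Gamma>\<^sub>1 \<Gamma>\<^sub>2 \<U>\<^sub>1 \<U>\<^sub>2 \<theta> ?\<psi>"
  proof unfold_locales
    show "complete_isometry \<U>\<^sub>2 \<U>\<^sub>1 ?\<psi>"
      by (rule complete_isometry_inverse[OF assms(5) os assms(6)])
    show "?\<psi> (id_op \<Gamma>\<^sub>2) = id_op \<Gamma>\<^sub>1"
      using inv_into_f_f[OF inj id] assms(7) by simp
    show "?\<psi> (\<theta> T) = T" if "T \<in> \<U>\<^sub>1" for T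
      by (rule inv_into_f_f[OF inj that])
    show "\<theta> (?\<psi> S) = S" if "S \<in> \<U>\<^sub>2" for S
      using that assms(6) by (intro f_inv_into_f) simp
  qed (fact assms)+
  then show ?thesis
    by (rule masa_isomorphism.unitary_equivalence)
qed

end
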